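(* Let $\tau=\sup\{t\ge 0:\hat g_{n,0}(t)+\hat g_{n,1}(t)>0\}$ and $\hat G_n(t)=\hat G_{n,0}(t)+\hat G_{n,1}(t)$ for $t\ge 0$. Consider the parameterized curve in $\mathbb{R}_+^2$ (the continuous cumulative sum diagram, CCSD) $$t\mapsto(\hat G_n(t),\hat G_{n,1}(t)),\qquad t\in[0,\tau].$$ Let $\hat F_n^{\mathrm{MS}}(t)$ be the right-continuous slope of the lower convex hull of the CCSD, evaluated at the point with $x$-coordinate $\hat G_n(t)$. Then $\hat F_n^{\mathrm{MS}}$ is the unique maximizer of $$l^S(F)=\int\log(1-F(t))\,d\hat G_{n,0}(t)+\int\log F(t)\,d\hat G_{n,1}(t)$$ over the class of all sub-distribution functions $F$.
   Context: Current status model: $X_1,X_2,\dots$ are i.i.d. with distribution function $F_0$ on $[0,\infty)$, and, independently, $T_1,T_2,\dots$ are i.i.d. with distribution function $G$ on $[0,\infty)$ having Lebesgue density $g$. One observes $(T_i,\Delta_i)$, $1\le i\le n$, with $\Delta_i=1_{\{X_i\le T_i\}}$. For $i=0,1$ the empirical sub-distribution functions are $\mathbb{G}_{n,i}(t)=\frac1n\sum_{j=1}^n 1_{[0,t]\times\{i\}}(T_j,\Delta_j)$. For $i=0,1$, $\hat G_{n,i}$ is a smoothed version of $\mathbb{G}_{n,i}$ (e.g. obtained by kernel smoothing): a sub-distribution function on $[0,\infty)$ with Lebesgue density $\hat g_{n,i}$. The functional $l^S$ is the smoothed log likelihood. Conventions: $\log 0=-\infty$, $0\cdot\infty=0$.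 A sub-distribution function is a nondecreasing right-continuous function with values in $[0,1]$. $\hat F_n^{\mathrm{MS}}$ is called the maximum smoothed likelihood estimator of $F_0$.
   Formalization: Uniqueness is up to dĜ_n-null sets, and pointwise at each t where Ĝ_n increases to the right (strict uniqueness fails where Ĝ_n is flat); at the right end of the hull (t ≥ τ) the slope is the left derivative, and it is 0 if the total mass is 0. *)

theory Defs
  imports "HOL-Analysis.Analysis"
begin

text \<open>
  Functions on the half-line are modelled as functions on the reals of which only the values
  at nonnegative arguments matter.
\<close>

definition sub_distribution :: "(real \<Rightarrow> real) \<Rightarrow> bool" where
  "sub_distribution F \<longleftrightarrow>
     mono_on {0..} F \<and>
     (\<forall>t\<ge>0. continuous (at_right t) F) \<and>
     (\<forall>t\<ge>0. 0 \<le> F t \<and> F t \<le> 1)"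

definition has_lebesgue_density :: "(real \<Rightarrow> real) \<Rightarrow> (real \<Rightarrow> real) \<Rightarrow> bool" where
  "has_lebesgue_density G g \<longleftrightarrow>
     (\<forall>t\<ge>0. 0 \<le> g t) \<and>
     (\<forall>t\<ge>0. set_integrable lebesgue {0..t} g \<and> G t = (LINT s:{0..t}|lebesgue. g s))"

text \<open>The Lebesgue--Stieltjes measure of a function on the half-line, extended by 0 to the left.\<close>

definition stieltjes :: "(real \<Rightarrow> real) \<Rightarrow> real measure" where
  "stieltjes G = interval_measure (\<lambda>t. if t < 0 then 0 else G t)"

definition log_ext :: "real \<Rightarrow> ereal" where
  "log_ext x = (if x \<le> 0 then - \<infinity> else ereal (ln x))"

text \<open>
  Both integrands below are nonpositive, so each integral is a well-defined element of
  \<open>[-\<infinity>, 0]\<close>, computed as minus the integral of the negated integrand. Null sets contribute 0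
  even where the logarithm is \<open>-\<infinity>\<close>.
\<close>

definition integral_nonpos :: "(real \<Rightarrow> real) \<Rightarrow> (real \<Rightarrow> ereal) \<Rightarrow> ereal" where
  "integral_nonpos G h =
     - enn2ereal (\<integral>\<^sup>+t\<in>{0..}. e2ennreal (- h t) \<partial>stieltjes G)"

definition smoothed_loglik :: "(real \<Rightarrow> real) \<Rightarrow> (real \<Rightarrow> real) \<Rightarrow> (real \<Rightarrow> real) \<Rightarrow> ereal" where
  "smoothed_loglik G0 G1 F =
     integral_nonpos G0 (\<lambda>t. log_ext (1 - F t)) + integral_nonpos G1 (\<lambda>t. log_ext (F t))"

definition support_end :: "(real \<Rightarrow> real) \<Rightarrow> (real \<Rightarrow> real) \<Rightarrow> ereal" where
  "support_end g0 g1 = (SUP t\<in>{t. 0 \<le> t \<and> 0 < g0 t + g1 t}. ereal t)"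

definition ccsd ::
    "(real \<Rightarrow> real) \<Rightarrow> (real \<Rightarrow> real) \<Rightarrow> (real \<Rightarrow> real) \<Rightarrow> (real \<Rightarrow> real) \<Rightarrow> (real \<times> real) set" where
  "ccsd G0 G1 g0 g1 = {(G0 t + G1 t, G1 t) | t. 0 \<le> t \<and> ereal t \<le> support_end g0 g1}"

definition lower_hull :: "(real \<times> real) set \<Rightarrow> real \<Rightarrow> real" where
  "lower_hull C x = Inf {y. (x, y) \<in> convex hull C}"

text \<open>
  Right derivative of the lower convex hull. At the right end point of the hull there is no
  right derivative and the left derivative is used; for a hull lying over a single point
  (a diagram of total mass 0) the slope is 0 by convention.
\<close>

definition hull_slope :: "(real \<times> real) set \<Rightarrow> real \<Rightarrow> real" where
  "hull_slope C x =
     (if \<exists>p\<in>C. x < fst p then vector_derivative (lower_hull C) (at_right x)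
      else if \<exists>p\<in>C. fst p < x then vector_derivative (lower_hull C) (at_left x)
      else 0)"

definition msle ::
    "(real \<Rightarrow> real) \<Rightarrow> (real \<Rightarrow> real) \<Rightarrow> (real \<Rightarrow> real) \<Rightarrow> (real \<Rightarrow> real) \<Rightarrow> real \<Rightarrow> real" where
  "msle G0 G1 g0 g1 t = hull_slope (ccsd G0 G1 g0 g1) (G0 t + G1 t)"

end

theory Submission
  imports Defs
begin

text \<open>
  Let \<open>G = G0 + G1\<close>, let \<open>H\<close> be the lower convex hull of the diagram, let \<open>Fhat t\<close> be its slope at
  abscissa \<open>G t\<close> and put \<open>K t = H (G t)\<close>. Then \<open>dK = Fhat dG\<close>, so that \<open>\<nu>1 = Fhat dG\<close> and
  \<open>\<nu>0 = (1 - Fhat) dG\<close> are the measures that the hull would produce if it were itself a diagram.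
  Maximizing the likelihood means minimizing
  \<open>loss F = \<integral> - log (1 - F) dG0 + \<integral> - log F dG1\<close>, and the proof compares this integral with the
  same integral against \<open>\<nu>0\<close> and \<open>\<nu>1\<close>.

  The hull lies below the diagram and catches up with it at the right end. Hence every
  initial segment of the line has at least as much \<open>dG1\<close>-mass as \<open>\<nu>1\<close>-mass, every final segment
  at least as much \<open>dG0\<close>-mass as \<open>\<nu>0\<close>-mass (\<open>segment_dominance\<close>). For nondecreasing \<open>F\<close> the
  superlevel sets of \<open>- log F\<close> are initial segments and those of \<open>- log (1 - F)\<close> final segments,
  so integrating over the levels gives
  \<open>loss F \<ge> \<integral> - (1 - Fhat) log (1 - F) - Fhat log F dG\<close> (\<open>loss_ge\<close>).
  The integrand on the right is the cross entropy of two Bernoulli laws, which by Gibbs'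
  inequality is minimal exactly at \<open>F = Fhat\<close> (\<open>cross_entropy_less\<close>).
  For \<open>F = Fhat\<close> the first inequality is an equality (\<open>loss_Fhat\<close>): the hull touches the diagram
  wherever its slope increases (\<open>touching\<close>), so both pairs of measures agree on all sublevel
  sets of \<open>Fhat\<close>.

  Since the minimal loss is finite, a second minimizer attains equality in Gibbs' inequality
  and thus coincides with \<open>Fhat\<close> almost everywhere with respect to \<open>dG\<close>; right-continuity
  extends this to every point of right increase of \<open>G\<close>.
\<close>

section \<open>One-sided derivatives of convex functions\<close>

text \<open>
  Identifies two interval functions that are squeezed between the same lower and upper sums: their
  difference has increments of second order. Splitting an interval where \<open>B\<close> takes its mean value
  halves the bound, and iterating this sends it to 0.
\<close>

lemma constant_if_increments_le_product:
  fixes A B E :: "real \<Rightarrow> real"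
  assumes B: "continuous_on UNIV B"
    and incr: "\<And>s t. s \<le> t \<Longrightarrow> \<bar>E t - E s\<bar> \<le> (A t - A s) * (B t - B s)"
    and "s \<le> t"
  shows "E t = E s"
proof -
  have halved: "\<bar>E t - E s\<bar> \<le> (A t - A s) * (B t - B s) / 2 ^ n" if "s \<le> t" for n s t
    using that
  proof (induction n arbitrary: s t)
    case 0
    then show ?case using incr by simp
  next
    case (Suc n)
    define b where "b = (B s + B t) / 2"
    have "\<exists>m\<ge>s. m \<le> t \<and> B m = b"
    proof (cases "B s \<le> B t")
      case True
      then show ?thesis using Suc.prems
        by (intro IVT') (auto simp: b_def intro: continuous_on_subset[OF B])
    next
      case False
      then show ?thesis using Suc.prems
        by (intro IVT2') (auto simp: b_def intro: continuous_on_subset[OF B])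
    qed
    then obtain m where m: "s \<le> m" "m \<le> t" "B m = b" by blast
    have "\<bar>E t - E s\<bar> \<le> \<bar>E t - E m\<bar> + \<bar>E m - E s\<bar>" by simp
    also have "\<dots> \<le> (A t - A m) * (B t - B m) / 2 ^ n + (A m - A s) * (B m - B s) / 2 ^ n"
      using Suc.IH m by (intro add_mono) auto
    also have "\<dots> = ((A t - A m) * (B t - B s) / 2 + (A m - A s) * (B t - B s) / 2) / 2 ^ n"
      unfolding m(3) b_def by (simp add: field_simps)
    also have "\<dots> = (A t - A s) * (B t - B s) / 2 ^ Suc n"
      by (simp add: field_simps)
    finally show ?case .
  qed
  have "(\<lambda>n. (A t - A s) * (B t - B s) / 2 ^ n) \<longlonglongrightarrow> 0"
    using tendsto_mult[OF tendsto_const LIMSEQ_inverse_realpow_zero[of 2]]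
    by (simp add: divide_inverse)
  then have "\<bar>E t - E s\<bar> \<le> 0"
    by (rule LIMSEQ_le_const) (use halved \<open>s \<le> t\<close> in blast)
  then show ?thesis by simp
qed

text \<open>
  The difference quotients of a convex function from a fixed point decrease as the second point
  approaches the first; monotonicity of the function bounds them below, so the right derivative exists
  also at the left end point of the domain. The two claims together say that it is their infimum.
\<close>

lemma convex_on_at_right_vector_derivative:
  fixes f :: "real \<Rightarrow> real"
  assumes f: "convex_on S f" and x: "x \<in> S" and y: "y \<in> S" "x < y"
    and bnd: "\<And>u v. u \<in> S \<Longrightarrow> v \<in> S \<Longrightarrow> u \<le> v \<Longrightarrow> 0 \<le> f v - f u"
  defines "d \<equiv> vector_derivative f (at_right x)"
  shows "z \<in> S \<Longrightarrow> x < z \<Longrightarrow> d \<le> (f z - f x) / (z - x)"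
    and "d < e \<Longrightarrow> \<exists>z\<in>S. x < z \<and> (f z - f x) / (z - x) < e"
proof -
  define q where "q z = (f z - f x) / (z - x)" for z
  define d0 where "d0 = (INF z\<in>S \<inter> {x<..}. q z)"
  have S: "convex S" using f by (simp add: convex_on_def)
  have bdd: "bdd_below (q ` (S \<inter> {x<..}))"
    by (rule bdd_belowI[of _ 0]) (use bnd x in \<open>auto simp: q_def\<close>)
  have ne: "q ` (S \<inter> {x<..}) \<noteq> {}" using y by auto
  have lower: "d0 \<le> q z" if "z \<in> S" "x < z" for z
    unfolding d0_def by (rule cINF_lower[OF bdd]) (use that in auto)
  have approx: "\<exists>z\<in>S. x < z \<and> q z < e" if "d0 < e" for e
    using that cInf_lessD[OF ne, of e] unfolding d0_def by auto
  have between: "z \<in> S" if "w \<in> S" "x \<le> z" "z \<le> w" for z w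
    using S that x by (meson atLeastAtMost_iff is_interval_1 is_interval_convex_1)
  have qmono: "q z \<le> q w" if "w \<in> S" "x < z" "z < w" for z w
    using convex_on_slope_le(1)[OF f x, of w z] that
    unfolding q_def by (smt (verit, best) minus_divide_divide)
  have "(q \<longlongrightarrow> d0) (at_right x)"
  proof (rule order_tendstoI)
    fix a assume "a < d0"
    then show "\<forall>\<^sub>F z in at_right x. a < q z"
      unfolding eventually_at_right[OF y(2)] using y lower between
      by (meson less_imp_le order.strict_trans2)
  next
    fix a assume "d0 < a"
    then obtain w where w: "w \<in> S" "x < w" "q w < a" using approx by blast
    then show "\<forall>\<^sub>F z in at_right x. q z < a"
      unfolding eventually_at_right[OF w(2)]
      using qmono by (meson order.strict_trans1 less_imp_le)
  qed
  then have "(f has_vector_derivative d0) (at_right x)"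
    by (simp add: q_def[abs_def] has_real_derivative_iff_has_vector_derivative[symmetric]
        has_field_derivative_iff)
  then have "d = d0"
    unfolding d_def by (intro vector_derivative_within) (auto simp: trivial_limit_at_right_real)
  then show "z \<in> S \<Longrightarrow> x < z \<Longrightarrow> d \<le> (f z - f x) / (z - x)"
    and "d < e \<Longrightarrow> \<exists>z\<in>S. x < z \<and> (f z - f x) / (z - x) < e"
    using lower approx by (auto simp: q_def)
qed

text \<open>
  At the right end point of the domain, where only the left derivative makes sense, the role of
  monotonicity is played by the one-sided Lipschitz bound, which survives in the derivative.
\<close>

lemma convex_on_at_left_vector_derivative:
  fixes f :: "real \<Rightarrow> real"
  assumes f: "convex_on S f" and x: "x \<in> S" and y: "y \<in> S" "y < x"
    and bnd: "\<And>u v. u \<in> S \<Longrightarrow> v \<in> S \<Longrightarrow> u \<le> v \<Longrightarrow> f v - f u \<le> L * (v - u)"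
  defines "d \<equiv> vector_derivative f (at_left x)"
  shows "z \<in> S \<Longrightarrow> z < x \<Longrightarrow> (f x - f z) / (x - z) \<le> d"
    and "d \<le> L"
proof -
  define q where "q z = (f x - f z) / (x - z)" for z
  define d0 where "d0 = (SUP z\<in>S \<inter> {..<x}. q z)"
  have S: "convex S" using f by (simp add: convex_on_def)
  have qL: "q z \<le> L" if "z \<in> S" "z < x" for z
    using bnd[of z x] x that by (auto simp: q_def field_simps)
  have bdd: "bdd_above (q ` (S \<inter> {..<x}))"
    by (rule bdd_aboveI[of _ L]) (use qL in auto)
  have ne: "q ` (S \<inter> {..<x}) \<noteq> {}" using y by auto
  have upper: "q z \<le> d0" if "z \<in> S" "z < x" for z
    unfolding d0_def by (rule cSUP_upper[OF _ bdd]) (use that in auto)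
  have approx: "\<exists>z\<in>S. z < x \<and> e < q z" if "e < d0" for e
    using that less_cSupD[OF ne, of e] unfolding d0_def by auto
  have between: "z \<in> S" if "w \<in> S" "w \<le> z" "z \<le> x" for z w
    using S that x by (meson atLeastAtMost_iff is_interval_1 is_interval_convex_1)
  have qmono: "q w \<le> q z" if "w \<in> S" "w < z" "z < x" for z w
    using convex_on_slope_le(2)[OF f that(1) x, of z] that
    unfolding q_def by (smt (verit, best) minus_divide_divide)
  have "(q \<longlongrightarrow> d0) (at_left x)"
  proof (rule order_tendstoI)
    fix a assume "a < d0"
    then obtain w where w: "w \<in> S" "w < x" "a < q w" using approx by blast
    then show "\<forall>\<^sub>F z in at_left x. a < q z"
      unfolding eventually_at_left[OF w(2)]
      using qmono by (meson order.strict_trans2 less_imp_le)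
  next
    fix a assume "d0 < a"
    then show "\<forall>\<^sub>F z in at_left x. q z < a"
      unfolding eventually_at_left[OF y(2)] using y upper between
      by (meson less_imp_le order.strict_trans1)
  qed
  moreover have "q = (\<lambda>z. (f z - f x) / (z - x))"
    by (rule ext) (simp add: q_def, metis minus_diff_eq minus_divide_divide)
  ultimately have "(f has_vector_derivative d0) (at_left x)"
    by (simp add: has_real_derivative_iff_has_vector_derivative[symmetric] has_field_derivative_iff)
  then have d: "d = d0"
    unfolding d_def by (intro vector_derivative_within) (auto simp: trivial_limit_at_left_real)
  then show "z \<in> S \<Longrightarrow> z < x \<Longrightarrow> (f x - f z) / (x - z) \<le> d"
    using upper by (auto simp: q_def)
  have "d0 \<le> L" unfolding d0_def by (rule cSUP_least) (use ne qL in auto)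
  then show "d \<le> L" using d by simp
qed

section \<open>The lower convex hull of a monotone curve\<close>

text \<open>
  The curve is parameterized by the whole line instead of the half-line. It rests at the origin for
  negative parameters, which adds no point to the diagram and makes all functions involved
  monotone on the whole line.
\<close>

locale cusum_curve =
  fixes G0 G1 :: "real \<Rightarrow> real"
  assumes mono_G0: "mono G0" and mono_G1: "mono G1"
    and cont_G0: "continuous_on UNIV G0" and cont_G1: "continuous_on UNIV G1"
    and G0_nonpos: "t \<le> 0 \<Longrightarrow> G0 t = 0" and G1_nonpos: "t \<le> 0 \<Longrightarrow> G1 t = 0"
    and G0_le_1: "G0 t \<le> 1" and G1_le_1: "G1 t \<le> 1"
begin

definition G :: "real \<Rightarrow> real" where "G t = G0 t + G1 t"

definition diagram :: "(real \<times> real) set" where "diagram = range (\<lambda>t. (G t, G1 t))"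

definition H :: "real \<Rightarrow> real" where "H = lower_hull diagram"

definition Fhat :: "real \<Rightarrow> real" where "Fhat t = hull_slope diagram (G t)"

lemma G0_mono: "s \<le> t \<Longrightarrow> G0 s \<le> G0 t" and G1_mono: "s \<le> t \<Longrightarrow> G1 s \<le> G1 t"
  using mono_G0 mono_G1 by (auto simp: mono_def)

lemma G_mono: "s \<le> t \<Longrightarrow> G s \<le> G t"
  unfolding G_def using G0_mono G1_mono by (simp add: add_mono)

lemma G0_nonneg: "0 \<le> G0 t" and G1_nonneg: "0 \<le> G1 t"
  using G0_mono[of 0 t] G1_mono[of 0 t] G0_nonpos[of t] G1_nonpos[of t] G0_nonpos[of 0] G1_nonpos[of 0]
  by (cases "t \<le> 0"; simp)+

lemma G_nonpos: "t \<le> 0 \<Longrightarrow> G t = 0"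
  by (simp add: G_def G0_nonpos G1_nonpos)

lemma cont_G: "continuous_on UNIV G"
  unfolding G_def[abs_def] by (intro continuous_on_add cont_G0 cont_G1)

lemma in_diagram: "(G t, G1 t) \<in> convex hull diagram"
  unfolding diagram_def by (rule hull_inc) blast

text \<open>
  The convex hull stays in every half-plane above a line that contains the diagram. This turns
  a line below the diagram into a lower bound for the function \<open>H\<close>.
\<close>

lemma affine_le_hull:
  assumes "\<And>t. a + c * G t \<le> G1 t" and "(x, v) \<in> convex hull diagram"
  shows "a + c * x \<le> v"
proof -
  have "convex hull diagram \<subseteq> {p. inner (c, -1) p \<le> - a}"
  proof (rule hull_minimal)
    show "diagram \<subseteq> {p. inner (c, -1) p \<le> - a}"
      using assms(1) by (auto simp: diagram_def algebra_simps)
  qed (rule convex_halfspace_le)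
  then show ?thesis using assms(2) by fastforce
qed

lemma hull_nonneg: "(x, v) \<in> convex hull diagram \<Longrightarrow> 0 \<le> v"
  using affine_le_hull[of 0 0] G1_nonneg by auto

text \<open>
  On the diagram the abscissa minus the ordinate equals \<open>G0\<close>, and the sets where it is at most \<open>G0 t\<close>
  are half-planes that grow with \<open>t\<close>; their union is therefore convex.
\<close>

lemma hull_le_abscissa: "(x, v) \<in> convex hull diagram \<Longrightarrow> \<exists>t\<ge>t0. x - v \<le> G0 t"
proof -
  have dir: "\<exists>t\<ge>t0. u * a + v * b \<le> G0 t"
    if "a \<le> G0 t" "b \<le> G0 t'" "t \<ge> t0" "t' \<ge> t0" "0 \<le> u" "0 \<le> v" "u + v = 1" for a b t t' u v
  proof (intro exI[of _ "max t t'"] conjI)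
    have "a \<le> G0 (max t t')" "b \<le> G0 (max t t')"
      using that G0_mono[of t "max t t'"] G0_mono[of t' "max t t'"] by auto
    then show "u * a + v * b \<le> G0 (max t t')"
      by (rule convex_bound_le) (use that in auto)
  qed (use that in auto)
  have "convex hull diagram \<subseteq> {p. \<exists>t\<ge>t0. fst p - snd p \<le> G0 t}"
  proof (rule hull_minimal)
    show "diagram \<subseteq> {p. \<exists>t\<ge>t0. fst p - snd p \<le> G0 t}"
    proof (auto simp: diagram_def G_def)
      fix t show "\<exists>s\<ge>t0. G0 t \<le> G0 s"
        by (intro exI[of _ "max t t0"]) (auto intro: G0_mono)
    qed
    show "convex {p. \<exists>t\<ge>t0. fst p - snd p \<le> G0 t}"
    proof (rule convexI, clarsimp)
      fix a b a' b' u v t t' :: real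
      assume "0 \<le> u" "0 \<le> v" "u + v = 1" "t0 \<le> t" "a - b \<le> G0 t" "t0 \<le> t'" "a' - b' \<le> G0 t'"
      then show "\<exists>t\<ge>t0. u * a + v * a' - (u * b + v * b') \<le> G0 t"
        using dir[of "a - b" t "a' - b'" t' u v] by (auto simp: algebra_simps)
    qed
  qed
  then show "(x, v) \<in> convex hull diagram \<Longrightarrow> \<exists>t\<ge>t0. x - v \<le> G0 t" by fastforce
qed

lemma H_le: "(x, v) \<in> convex hull diagram \<Longrightarrow> H x \<le> v"
  unfolding H_def lower_hull_def
  by (rule cInf_lower) (auto intro!: bdd_belowI[of _ 0] hull_nonneg)

lemma le_H:
  assumes "x \<in> range G" and "\<And>v. (x, v) \<in> convex hull diagram \<Longrightarrow> w \<le> v"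
  shows "w \<le> H x"
  unfolding H_def lower_hull_def
  by (rule cInf_greatest) (use assms in_diagram in auto)

lemma H_approx:
  assumes "x \<in> range G" and "0 < e"
  obtains v where "(x, v) \<in> convex hull diagram" "v < H x + e"
  using le_H[OF assms(1), of "H x + e"] assms(2) by force

lemma affine_le_H:
  assumes "\<And>t. a + c * G t \<le> G1 t" and "x \<in> range G"
  shows "a + c * x \<le> H x"
  using affine_le_hull[OF assms(1)] le_H[OF assms(2)] by blast

lemma H_G_le: "H (G t) \<le> G1 t"
  by (rule H_le[OF in_diagram])

lemma H_nonneg: "x \<in> range G \<Longrightarrow> 0 \<le> H x"
  using affine_le_H[of 0 0 x] G1_nonneg by simp

lemma zero_in_range: "0 \<in> range G"
  by (metis G_nonpos order_refl rangeI)

lemma H_0: "H 0 = 0"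
  using H_G_le[of 0] H_nonneg[OF zero_in_range] G_nonpos[of 0] G1_nonpos[of 0] by simp

lemma convex_range_G: "convex (range G)"
  using connected_continuous_image[OF cont_G] by (simp add: is_interval_connected_1[symmetric] is_interval_convex_1[symmetric])

lemma convex_H: "convex_on (range G) H"
  unfolding convex_on_def
proof (intro conjI convex_range_G ballI allI impI)
  fix x y u v :: real
  assume x: "x \<in> range G" and y: "y \<in> range G" and uv: "0 \<le> u" "0 \<le> v" "u + v = 1"
  show "H (u *\<^sub>R x + v *\<^sub>R y) \<le> u * H x + v * H y"
  proof (rule field_le_epsilon)
    fix e :: real assume "0 < e"
    obtain a where a: "(x, a) \<in> convex hull diagram" "a < H x + e" using H_approx[OF x \<open>0 < e\<close>] .
    obtain b where b: "(y, b) \<in> convex hull diagram" "b < H y + e" using H_approx[OF y \<open>0 < e\<close>] .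
    have "u *\<^sub>R (x, a) + v *\<^sub>R (y, b) \<in> convex hull diagram"
      using convexD[OF convex_convex_hull a(1) b(1)] uv by blast
    then have "H (u *\<^sub>R x + v *\<^sub>R y) \<le> u * a + v * b" by (intro H_le) simp
    also have "\<dots> \<le> u * (H x + e) + v * (H y + e)"
      using a b uv by (intro add_mono mult_left_mono) auto
    also have "\<dots> = u * H x + v * H y + (u + v) * e" by (simp add: algebra_simps)
    finally show "H (u *\<^sub>R x + v *\<^sub>R y) \<le> u * H x + v * H y + e" using uv by simp
  qed
qed

lemma H_mono:
  assumes "x \<in> range G" "y \<in> range G" "x \<le> y"
  shows "H x \<le> H y"
proof (cases "x = y")
  case False
  have "0 \<le> x" using assms(1) G0_nonneg G1_nonneg by (auto simp: G_def)
  with False assms have xy: "0 \<le> x" "0 < y" "x / y \<le> 1" by auto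
  have "H x \<le> (1 - x / y) * H 0 + x / y * H y"
    using convex_onD[OF convex_H, of "x / y" 0 y] xy zero_in_range assms by simp
  also have "\<dots> \<le> H y"
    using xy H_nonneg[OF assms(2)] mult_left_le_one_le[of "H y" "x / y"] by (simp add: H_0)
  finally show ?thesis .
qed simp

text \<open>
  From a hull point \<open>(x, v)\<close>, move along the chord to a point of the diagram far enough to the right
  that its value of \<open>G0\<close> is at least \<open>x - v\<close>; the chord has slope at most 1 and crosses the abscissa \<open>y\<close>.
\<close>

lemma H_slope_le_1:
  assumes "x \<in> range G" "y \<in> range G" "x \<le> y"
  shows "H y - H x \<le> y - x"
proof -
  have "H y \<le> v + (y - x)" if v: "(x, v) \<in> convex hull diagram" for v
  proof -
    obtain t0 where t0: "y = G t0" using assms by blast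
    obtain t where t: "t \<ge> t0" "x - v \<le> G0 t" using hull_le_abscissa[OF v] by blast
    define z where "z = G t"
    have z: "y \<le> z" "(z, G1 t) \<in> convex hull diagram"
      using t t0 G_mono in_diagram by (auto simp: z_def)
    have gap: "G1 t - v \<le> z - x" using t by (simp add: z_def G_def)
    show ?thesis
    proof (cases "x = z")
      case True
      then have "x = y" using assms z by simp
      then show ?thesis using H_le[OF v] by simp
    next
      case False
      define u where "u = (y - x) / (z - x)"
      have u: "0 \<le> u" "u \<le> 1" "u * (z - x) = y - x"
        using False assms z by (auto simp: u_def)
      have "(1 - u) *\<^sub>R (x, v) + u *\<^sub>R (z, G1 t) \<in> convex hull diagram"
        using convexD[OF convex_convex_hull v z(2)] u by simp
      moreover have "(1 - u) *\<^sub>R (x, v) + u *\<^sub>R (z, G1 t) = (y, v + u * (G1 t - v))"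
        using u by (simp add: algebra_simps)
      ultimately have "H y \<le> v + u * (G1 t - v)" using H_le by simp
      also have "\<dots> \<le> v + u * (z - x)" using gap u by (intro add_left_mono mult_left_mono) auto
      finally show ?thesis using u by simp
    qed
  qed
  then have "H y - (y - x) \<le> H x" by (intro le_H[OF assms(1)]) (simp add: algebra_simps)
  then show ?thesis by simp
qed

text \<open>
  What is needed about the slope: it lies in the unit interval, it separates the difference quotients to
  the right from those to the left, and unless the hull has ended it is the infimum of those to the
  right. At the right end of the hull the slope is a left derivative, or 0 if the hull is a single
  point.
\<close>

lemma Fhat_props:
  shows Fhat_nonneg: "0 \<le> Fhat t" and Fhat_le_1: "Fhat t \<le> 1"
    and slope_ge_Fhat: "t \<le> s \<Longrightarrow> Fhat t * (G s - G t) \<le> H (G s) - H (G t)"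
    and slope_le_Fhat: "s \<le> t \<Longrightarrow> H (G t) - H (G s) \<le> Fhat t * (G t - G s)"
    and Fhat_approx: "G t < G r \<Longrightarrow> Fhat t < e \<Longrightarrow>
      \<exists>s>t. G t < G s \<and> H (G s) - H (G t) < e * (G s - G t)"
proof -
  have ex_gt: "(\<exists>p\<in>diagram. x < fst p) \<longleftrightarrow> (\<exists>s. x < G s)"
    and ex_lt: "(\<exists>p\<in>diagram. fst p < x) \<longleftrightarrow> (\<exists>s. G s < x)" for x
    by (auto simp: diagram_def)
  have all: "0 \<le> Fhat t \<and> Fhat t \<le> 1 \<and>
     (\<forall>s\<ge>t. Fhat t * (G s - G t) \<le> H (G s) - H (G t)) \<and>
     (\<forall>s\<le>t. H (G t) - H (G s) \<le> Fhat t * (G t - G s)) \<and>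
     (\<forall>e r. G t < G r \<longrightarrow> Fhat t < e \<longrightarrow> (\<exists>s>t. G t < G s \<and> H (G s) - H (G t) < e * (G s - G t)))"
  proof (cases "\<exists>s. G t < G s")
    case True
    then obtain r where r: "G t < G r" by blast
    have Fhat: "Fhat t = vector_derivative H (at_right (G t))"
      using True by (simp add: Fhat_def hull_slope_def ex_gt H_def)
    have le: "Fhat t \<le> (H z - H (G t)) / (z - G t)" if "z \<in> range G" "G t < z" for z
      unfolding Fhat using that r H_mono
      by (intro convex_on_at_right_vector_derivative(1)[OF convex_H, of _ "G r"]) auto
    have approx: "\<exists>z\<in>range G. G t < z \<and> (H z - H (G t)) / (z - G t) < e" if "Fhat t < e" for e
      using that unfolding Fhat using r H_mono
      by (intro convex_on_at_right_vector_derivative(2)[OF convex_H, of _ "G r"]) auto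
    have "0 \<le> Fhat t"
    proof (rule ccontr)
      assume "\<not> 0 \<le> Fhat t"
      then obtain z where "z \<in> range G" "G t < z" "(H z - H (G t)) / (z - G t) < 0"
        using approx[of 0] by auto
      then show False using H_mono[of "G t" z] by (auto simp: divide_less_0_iff)
    qed
    moreover have "Fhat t \<le> 1"
      using le[OF _ r] H_slope_le_1[of "G t" "G r"] r
      by (smt (verit) divide_le_eq_1 rangeI)
    moreover have "Fhat t * (G s - G t) \<le> H (G s) - H (G t)" if "t \<le> s" for s
      using le[of "G s"] G_mono[OF that] by (cases "G t = G s") (auto simp: field_simps)
    moreover have "H (G t) - H (G s) \<le> Fhat t * (G t - G s)" if st: "s \<le> t" for s
    proof (cases "G s = G t")
      case False
      then have lt: "G s < G t" using G_mono[OF st] by simp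
      have "(H (G t) - H (G s)) / (G t - G s) \<le> Fhat t"
      proof (rule ccontr)
        assume "\<not> ?thesis"
        then obtain z where z: "z \<in> range G" "G t < z"
            "(H z - H (G t)) / (z - G t) < (H (G t) - H (G s)) / (G t - G s)"
          using approx by force
        have "(H (G s) - H (G t)) / (G s - G t) \<le> (H (G s) - H z) / (G s - z)"
          "(H (G s) - H z) / (G s - z) \<le> (H (G t) - H z) / (G t - z)"
          using convex_on_slope_le[OF convex_H, of "G s" z "G t"] lt z by auto
        then have "(H (G t) - H (G s)) / (G t - G s) \<le> (H z - H (G t)) / (z - G t)"
          by (smt (verit) minus_divide_divide)
        with z show False by simp
      qed
      then show ?thesis using lt by (simp add: field_simps)
    qed simp
    moreover have "\<exists>s>t. G t < G s \<and> H (G s) - H (G t) < e * (G s - G t)" if "Fhat t < e" for e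
    proof -
      obtain z where z: "z \<in> range G" "G t < z" "(H z - H (G t)) / (z - G t) < e"
        using approx[OF \<open>Fhat t < e\<close>] by blast
      then obtain s where s: "z = G s" by blast
      have "t < s" using z(2) G_mono[of s t] unfolding s by (meson not_le)
      then show ?thesis using z unfolding s by (auto simp: field_simps)
    qed
    ultimately show ?thesis by blast
  next
    case top: False
    then have eq: "G s = G t" if "t \<le> s" for s using G_mono[OF that] by (meson not_le order_antisym)
    show ?thesis
    proof (cases "\<exists>s. G s < G t")
      case True
      then obtain r where r: "G r < G t" by blast
      have Fhat: "Fhat t = vector_derivative H (at_left (G t))"
        using True top by (simp add: Fhat_def hull_slope_def ex_gt ex_lt H_def)
      have le: "(H (G t) - H z) / (G t - z) \<le> Fhat t" if "z \<in> range G" "z < G t" for z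
        unfolding Fhat using that r H_slope_le_1
        by (intro convex_on_at_left_vector_derivative(1)[OF convex_H, of _ "G r" 1]) auto
      have "0 \<le> (H (G t) - H (G r)) / (G t - G r)" using r H_mono[of "G r" "G t"] by simp
      then have "0 \<le> Fhat t" using le[of "G r"] r by simp
      moreover have "Fhat t \<le> 1"
        unfolding Fhat using r H_slope_le_1
        by (intro convex_on_at_left_vector_derivative(2)[OF convex_H, of _ "G r" 1]) auto
      moreover have "H (G t) - H (G s) \<le> Fhat t * (G t - G s)" if "s \<le> t" for s
        using le[of "G s"] G_mono[OF that] by (cases "G t = G s") (auto simp: field_simps)
      ultimately show ?thesis using eq top by (metis diff_self mult_zero_right order_refl)
    next
      case False
      then have "Fhat t = 0" using top by (simp add: Fhat_def hull_slope_def ex_gt ex_lt)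
      moreover have "G s - G t = 0" "G t - G s = 0" for s
        using top False by (auto simp: not_less intro: order_antisym)
      moreover have "H (G s) - H (G t) = 0" "H (G t) - H (G s) = 0" for s
        using top False by (metis diff_self not_less_iff_gr_or_eq)+
      ultimately show ?thesis using top by (simp only: mult_zero_right order_refl zero_le_one) simp
    qed
  qed
  show "0 \<le> Fhat t" by (rule all[THEN conjunct1])
  show "Fhat t \<le> 1" by (rule all[THEN conjunct2, THEN conjunct1])
  show "t \<le> s \<Longrightarrow> Fhat t * (G s - G t) \<le> H (G s) - H (G t)"
    by (rule all[THEN conjunct2, THEN conjunct2, THEN conjunct1, rule_format])
  show "s \<le> t \<Longrightarrow> H (G t) - H (G s) \<le> Fhat t * (G t - G s)"
    by (rule all[THEN conjunct2, THEN conjunct2, THEN conjunct2, THEN conjunct1, rule_format])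
  show "G t < G r \<Longrightarrow> Fhat t < e \<Longrightarrow>
      \<exists>s>t. G t < G s \<and> H (G s) - H (G t) < e * (G s - G t)"
    by (rule all[THEN conjunct2, THEN conjunct2, THEN conjunct2, THEN conjunct2, rule_format])
qed

lemma Fhat_cong: "G s = G t \<Longrightarrow> Fhat s = Fhat t"
  by (simp add: Fhat_def)

lemma Fhat_mono: "s \<le> t \<Longrightarrow> Fhat s \<le> Fhat t"
proof (cases "G s = G t")
  case True
  then show ?thesis by (simp add: Fhat_def)
next
  case False
  assume "s \<le> t"
  then have "Fhat s * (G t - G s) \<le> Fhat t * (G t - G s)"
    using slope_ge_Fhat slope_le_Fhat order_trans by meson
  then show ?thesis using False G_mono[OF \<open>s \<le> t\<close>] by simp
qed

lemma cont_H_G: "isCont (\<lambda>t. H (G t)) t"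
proof -
  have "norm (H (G s) - H (G t)) \<le> \<bar>G s - G t\<bar>" for s
    using H_slope_le_1[OF rangeI rangeI, of s t] H_slope_le_1[OF rangeI rangeI, of t s]
      H_mono[OF rangeI rangeI, of s t] H_mono[OF rangeI rangeI, of t s]
    unfolding real_norm_def by linarith
  then have "\<forall>\<^sub>F s in at t. norm (H (G s) - H (G t)) \<le> \<bar>G s - G t\<bar>"
    by (intro always_eventually allI)
  moreover have "((\<lambda>s. \<bar>G s - G t\<bar>) \<longlongrightarrow> 0) (at t)"
    using cont_G by (intro tendsto_rabs_zero LIM_zero) (simp add: continuous_on_eq_continuous_at isCont_def)
  ultimately have "((\<lambda>s. H (G s) - H (G t)) \<longlongrightarrow> 0) (at t)"
    by (rule Lim_null_comparison)
  then show ?thesis unfolding isCont_def by (rule LIM_zero_cancel)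
qed

text \<open>
  To the right of \<open>t\<close> the slope cannot drop, by monotonicity. It cannot jump up either: a chord from \<open>G t\<close>
  of slope below \<open>a\<close> keeps slope below \<open>a\<close> when its left end moves slightly to the right, and it bounds
  the slope of the hull at its left end.
\<close>

lemma Fhat_right_cont: "continuous (at_right t) Fhat"
  unfolding continuous_within
proof (rule order_tendstoI)
  fix a assume a: "a < Fhat t"
  have "a < Fhat s" if "t < s" for s
    using a Fhat_mono[of t s] that by simp
  then show "\<forall>\<^sub>F s in at_right t. a < Fhat s"
    by (rule eventually_mono[OF eventually_at_right_less])
next
  fix a assume a: "Fhat t < a"
  show "\<forall>\<^sub>F s in at_right t. Fhat s < a"
  proof (cases "\<exists>r. G t < G r")
    case False
    then have "Fhat s = Fhat t" if "t < s" for s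
      using G_mono[of t s] that by (intro Fhat_cong) (meson less_imp_le not_le order_antisym)
    with a have "Fhat s < a" if "t < s" for s using that by simp
    then show ?thesis by (rule eventually_mono[OF eventually_at_right_less])
  next
    case True
    then obtain r where r: "t < r" "G t < G r" "H (G r) - H (G t) < a * (G r - G t)"
      using Fhat_approx[OF _ a] by blast
    have "((\<lambda>s. a * (G r - G s) - (H (G r) - H (G s))) \<longlongrightarrow> a * (G r - G t) - (H (G r) - H (G t))) (at t)"
      using cont_G cont_H_G[of t] by (intro tendsto_intros) (auto simp: continuous_on_eq_continuous_at isCont_def)
    moreover have "((\<lambda>s. G r - G s) \<longlongrightarrow> G r - G t) (at t)"
      using cont_G by (intro tendsto_intros) (auto simp: continuous_on_eq_continuous_at isCont_def)
    ultimately have "\<forall>\<^sub>F s in at t. 0 < a * (G r - G s) - (H (G r) - H (G s)) \<and> 0 < G r - G s"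
      using r by (intro eventually_conj order_tendstoD(1)) auto
    then have "\<forall>\<^sub>F s in at_right t. 0 < a * (G r - G s) - (H (G r) - H (G s)) \<and> 0 < G r - G s"
      by (simp add: eventually_at_split)
    moreover have "\<forall>\<^sub>F s in at_right t. s < r" using r(1) by (rule eventually_at_right_real[THEN eventually_mono]) auto
    ultimately show ?thesis
    proof eventually_elim
      case (elim s)
      then have "Fhat s * (G r - G s) < a * (G r - G s)"
        using slope_ge_Fhat[of s r] by linarith
      then show ?case using elim by (meson mult_less_cancel_right_pos)
    qed
  qed
qed

text \<open>
  Suppose that the hull is strictly below the diagram at \<open>G t\<close>. Its mean slope over any interval that
  ends at \<open>G t\<close> is strictly less than its slope \<open>c\<close> at \<open>G t\<close>. A line with a slope strictly in between, through a point
  slightly above the hull at \<open>G t\<close>, is below the hull at some distance from \<open>G t\<close> and below the diagram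
  near \<open>G t\<close>. It thus lies below the whole diagram, hence below the hull, which is absurd.
\<close>

lemma touching:
  assumes lt: "\<And>s. s < t \<Longrightarrow> Fhat s < Fhat t"
  shows "H (G t) = G1 t"
proof (rule ccontr)
  assume "H (G t) \<noteq> G1 t"
  then have gap: "H (G t) < G1 t" using H_G_le[of t] by simp
  have pos: "0 < G t"
  proof (rule ccontr)
    assume "\<not> 0 < G t"
    then have "G t = 0" "G1 t = 0" using G0_nonneg[of t] G1_nonneg[of t] by (auto simp: G_def)
    then show False using gap H_0 by simp
  qed
  define x where "x = G t"
  \<comment> \<open>The radius within which the gap absorbs both the variation of the diagram (at most
  \<open>\<delta>\<close>) and the rise of the line (at most \<open>2 * \<delta>\<close>).\<close>
  define \<delta> where "\<delta> = min (x / 2) ((G1 t - H x) / 4)"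
  have \<delta>: "0 < \<delta>" "\<delta> < x" "4 * \<delta> \<le> G1 t - H x"
    using pos gap unfolding \<delta>_def x_def min_def by (auto simp: field_simps)
  have at: "\<exists>s. s \<le> t \<and> G s = y" if "0 \<le> y" "y \<le> x" for y
  proof -
    have "0 < t" using pos G_nonpos[of t] by force
    then show ?thesis using IVT'[of G 0 y t] that G_nonpos[of 0]
      by (auto simp: x_def intro: continuous_on_subset[OF cont_G])
  qed
  obtain s where s: "s \<le> t" "G s = x - \<delta>" using at[of "x - \<delta>"] \<delta> by auto
  \<comment> \<open>An intermediate point shows that the mean slope \<open>p\<close> from \<open>G s\<close> to \<open>x\<close> is strictly smaller than
  \<open>c\<close>: up to \<open>G m\<close> it is at most \<open>Fhat m\<close>, and from there on at most \<open>c\<close>.\<close>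
  obtain m where m: "m \<le> t" "G m = x - \<delta> / 2" using at[of "x - \<delta> / 2"] \<delta> by auto
  have ne: "s < m" using s m \<delta> G_mono[of m s] by force
  have mt: "m < t" using m \<delta> by (cases "m = t") (auto simp: x_def)
  define c where "c = Fhat t"
  define p where "p = (H x - H (G s)) / \<delta>"
  have "H x - H (G s) = (H x - H (G m)) + (H (G m) - H (G s))" by simp
  also have "\<dots> \<le> c * (\<delta> / 2) + Fhat m * (\<delta> / 2)"
    using slope_le_Fhat[OF m(1)] slope_le_Fhat[of s m] ne s m by (intro add_mono) (auto simp: c_def x_def)
  also have "\<dots> < c * (\<delta> / 2) + c * (\<delta> / 2)"
    using lt[OF mt] \<delta>(1) unfolding c_def
    by (intro add_strict_left_mono mult_strict_right_mono) simp_all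
  finally have pc: "p < c" using \<delta> by (simp add: p_def field_simps)
  have "H (G s) \<le> H x" unfolding x_def by (rule H_mono[OF rangeI rangeI G_mono[OF s(1)]])
  then have p0: "0 \<le> p" unfolding p_def using \<delta>(1) by simp
  have c1: "c \<le> 1" unfolding c_def by (rule Fhat_le_1)
  define c' where "c' = (p + c) / 2"
  have c': "p < c'" "c' < c" using pc by (auto simp: c'_def)
  define \<eta> where "\<eta> = (c - p) / 2 * \<delta>"
  have \<eta>: "0 < \<eta>" "\<eta> = (c' - p) * \<delta>" "\<eta> = (c - c') * \<delta>"
    using \<delta>(1) pc by (simp_all add: \<eta>_def c'_def field_simps)
  have \<eta>_le: "\<eta> \<le> \<delta>"
    using \<delta>(1) pc c1 p0 mult_right_mono[of "(c - p) / 2" 1 \<delta>] by (simp add: \<eta>_def)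
  have line: "(H x + \<eta> - c' * x) + c' * G u \<le> G1 u" for u
  proof -
    have eq: "(H x + \<eta> - c' * x) + c' * G u = H x + \<eta> + c' * (G u - x)"
      by (simp add: algebra_simps)
    consider "\<bar>G u - x\<bar> \<le> \<delta>" | "G u > x + \<delta>" | "G u < x - \<delta>" by linarith
    then show ?thesis
    proof cases
      case 1
      have "\<bar>G1 u - G1 t\<bar> \<le> \<bar>G u - x\<bar>"
        unfolding x_def G_def using G0_mono[of u t] G0_mono[of t u] G1_mono[of u t] G1_mono[of t u]
        by linarith
      then have "G1 t - \<delta> \<le> G1 u" using 1 by linarith
      moreover have "c' * (G u - x) \<le> \<delta>"
      proof -
        have "c' * (G u - x) \<le> c' * \<delta>" using 1 p0 c' by (intro mult_left_mono) linarith+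
        also have "\<dots> \<le> 1 * \<delta>" using \<delta>(1) c' c1 by (intro mult_right_mono) linarith+
        finally show ?thesis by simp
      qed
      ultimately show ?thesis unfolding eq using \<delta> \<eta>_le by linarith
    next
      case 2
      then have "t \<le> u" using G_mono[of u t] \<delta>(1) unfolding x_def by linarith
      then have "c * (G u - x) \<le> H (G u) - H x" unfolding c_def x_def by (rule slope_ge_Fhat)
      moreover have "(c - c') * \<delta> \<le> (c - c') * (G u - x)"
        using 2 c' by (intro mult_left_mono) linarith+
      then have "\<eta> \<le> c * (G u - x) - c' * (G u - x)"
        unfolding \<eta>(3) by (simp only: left_diff_distrib)
      ultimately show ?thesis unfolding eq using H_G_le[of u] by linarith
    next
      case 3
      have "(H (G u) - H x) / (G u - x) \<le> (H (G s) - H x) / (G s - x)"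
        using 3 s(2) \<delta>(1) unfolding x_def
        by (intro convex_on_slope_le(2)[OF convex_H rangeI rangeI]) linarith+
      then have "(H x - H (G u)) / (x - G u) \<le> p"
        unfolding p_def s(2)
        using minus_divide_divide[of "H x - H (G u)" "x - G u"]
          minus_divide_divide[of "H x - H (x - \<delta>)" \<delta>] by simp
      then have "H x - H (G u) \<le> p * (x - G u)"
        using 3 \<delta>(1) by (subst (asm) pos_divide_le_eq) linarith+
      moreover have "(c' - p) * \<delta> \<le> (c' - p) * (x - G u)"
        using 3 c' by (intro mult_left_mono) linarith+
      then have "\<eta> \<le> c' * (x - G u) - p * (x - G u)"
        unfolding \<eta>(2) by (simp only: left_diff_distrib)
      moreover have "c' * (x - G u) = - (c' * (G u - x))" by (simp add: algebra_simps)
      ultimately show ?thesis unfolding eq using H_G_le[of u] by linarith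
    qed
  qed
  have "(H x + \<eta> - c' * x) + c' * x \<le> H x"
    by (rule affine_le_H[OF line]) (simp add: x_def)
  then show False using \<eta> by simp
qed

text \<open>
  For the least such \<open>b\<close> the line of slope 1 through the right end of the diagram is \<open>x - b\<close>. It lies
  below the diagram and forces the hull up to the diagram there, even when the end is not attained.
\<close>

lemma deficit_le:
  assumes "\<And>s. G0 s \<le> b"
  shows "G1 t - H (G t) \<le> b - G0 t"
proof -
  have "- b + 1 * G t \<le> H (G t)"
    using assms by (intro affine_le_H) (auto simp: G_def)
  then show ?thesis by (simp add: G_def)
qed

end

section \<open>Comparing integrals through level sets\<close>

lemma nn_integral_eq_integral_levels:
  assumes M: "sigma_finite_measure M" and f: "f \<in> borel_measurable M"
  shows "(\<integral>\<^sup>+x. f x \<partial>M) = (\<integral>\<^sup>+y\<in>{0..}. emeasure M {x\<in>space M. ennreal y < f x} \<partial>lborel)"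
proof -
  interpret pair_sigma_finite M lborel
    using M by (simp add: pair_sigma_finite_def lborel.sigma_finite_measure_axioms)
  note [measurable] = f
  have level: "(\<integral>\<^sup>+y. indicator {y. 0 \<le> y \<and> ennreal y < c} y \<partial>lborel) = c" for c
  proof (cases c)
    case (real r)
    then have "{y. 0 \<le> y \<and> ennreal y < c} = {0..<r}" by (auto simp: ennreal_less_iff)
    then show ?thesis using real by simp
  next
    case top
    have "ennreal r \<le> emeasure lborel {(0::real)..}" if "0 \<le> r" for r :: real
      using emeasure_mono[of "{0..r}" "{0..}" lborel] that by simp
    then have "emeasure lborel {(0::real)..} = top"
    proof (cases "emeasure lborel {(0::real)..}")
      case (real r)
      with \<open>\<And>r. 0 \<le> r \<Longrightarrow> ennreal r \<le> emeasure lborel {(0::real)..}\<close>[of "r + 1"] show ?thesis by simp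
    qed
    moreover have "{y. 0 \<le> y \<and> ennreal y < c} = {0..}" using top by auto
    ultimately show ?thesis using top by simp
  qed
  define L where "L = {p \<in> space (M \<Otimes>\<^sub>M lborel). 0 \<le> snd p \<and> ennreal (snd p) < f (fst p)}"
  have L: "L \<in> sets (M \<Otimes>\<^sub>M lborel)" unfolding L_def by measurable
  have "(\<integral>\<^sup>+x. f x \<partial>M) = (\<integral>\<^sup>+x. (\<integral>\<^sup>+y. indicator {y. 0 \<le> y \<and> ennreal y < f x} y \<partial>lborel) \<partial>M)"
    by (simp only: level)
  also have "\<dots> = (\<integral>\<^sup>+x. (\<integral>\<^sup>+y. indicator L (x, y) \<partial>lborel) \<partial>M)"
    by (intro nn_integral_cong) (auto simp: L_def space_pair_measure indicator_def)
  also have "\<dots> = (\<integral>\<^sup>+y. (\<integral>\<^sup>+x. indicator L (x, y) \<partial>M) \<partial>lborel)"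
    by (rule Fubini[of "indicator L", symmetric]) (rule borel_measurable_indicator[OF L])
  also have "\<dots> = (\<integral>\<^sup>+y. (\<integral>\<^sup>+x. indicator {0..} y * indicator {x\<in>space M. ennreal y < f x} x \<partial>M) \<partial>lborel)"
    by (intro nn_integral_cong) (auto simp: L_def space_pair_measure indicator_def)
  also have "\<dots> = (\<integral>\<^sup>+y\<in>{0..}. emeasure M {x\<in>space M. ennreal y < f x} \<partial>lborel)"
    by (intro nn_integral_cong) (simp add: nn_integral_cmult mult.commute)
  finally show ?thesis .
qed

lemma nn_integral_mono_levels:
  assumes "sigma_finite_measure M" "sigma_finite_measure N"
    and "f \<in> borel_measurable M" "f \<in> borel_measurable N"
    and "\<And>y. 0 \<le> y \<Longrightarrow> emeasure M {x\<in>space M. ennreal y < f x} \<le> emeasure N {x\<in>space N. ennreal y < f x}"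
  shows "(\<integral>\<^sup>+x. f x \<partial>M) \<le> (\<integral>\<^sup>+x. f x \<partial>N)"
  unfolding nn_integral_eq_integral_levels[OF assms(1,3)] nn_integral_eq_integral_levels[OF assms(2,4)]
  by (intro nn_integral_mono) (auto simp: indicator_def assms(5))

text \<open>
  The sublevel sets determine the distribution of \<open>f\<close> under a finite measure. The sign change turns
  them into the open upper half-lines that serve as generator.
\<close>

lemma nn_integral_comp_eq_of_sublevels:
  fixes f :: "'a \<Rightarrow> real"
  assumes "finite_measure M" and [measurable]: "f \<in> borel_measurable M" "f \<in> borel_measurable N"
    and sub: "\<And>c. emeasure M {x\<in>space M. f x < c} = emeasure N {x\<in>space N. f x < c}"
    and [measurable]: "k \<in> borel_measurable borel"
  shows "(\<integral>\<^sup>+x. k (f x) \<partial>M) = (\<integral>\<^sup>+x. k (f x) \<partial>N)"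
proof -
  interpret finite_measure M by fact
  have level: "emeasure (distr L borel (\<lambda>x. - f x)) {a<..} = emeasure L {x\<in>space L. f x < - a}"
    if [measurable]: "f \<in> borel_measurable L" for L a
    by (subst emeasure_distr) (auto intro!: arg_cong[where f="emeasure L"])
  have "distr M borel (\<lambda>x. - f x) = distr N borel (\<lambda>x. - f x)"
    by (rule measure_eqI_lessThan) (auto simp: level sub[symmetric] less_top[symmetric])
  then have "(\<integral>\<^sup>+y. k (- y) \<partial>distr M borel (\<lambda>x. - f x)) = (\<integral>\<^sup>+y. k (- y) \<partial>distr N borel (\<lambda>x. - f x))"
    by simp
  then show ?thesis by (simp add: nn_integral_distr)
qed

lemma emeasure_interval_measure_atMost:
  fixes F :: "real \<Rightarrow> real"
  assumes F: "mono F" "continuous_on UNIV F" "\<And>t. t \<le> 0 \<Longrightarrow> F t = 0"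
  shows "emeasure (interval_measure F) {..t} = ennreal (F t)"
    and "emeasure (interval_measure F) {t} = 0"
proof -
  have mono: "F x \<le> F y" if "x \<le> y" for x y using F(1) that by (simp add: mono_def)
  have Ioc: "emeasure (interval_measure F) {a..b} = F b - F a" if "a \<le> b" for a b
    by (rule emeasure_interval_measure_Icc[OF that mono F(2)])
  show "emeasure (interval_measure F) {t} = 0" using Ioc[of t t] by simp
  have "(\<lambda>n. emeasure (interval_measure F) {- real n..t}) \<longlonglongrightarrow> emeasure (interval_measure F) (\<Union>n. {- real n..t})"
    by (rule Lim_emeasure_incseq) (auto simp: incseq_def)
  moreover have "(\<Union>n. {- real n..t}) = {..t}"
  proof -
    have "\<exists>n. - real n \<le> x" for x using real_arch_simple[of "- x"] by (auto simp: minus_le_iff)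
    then show ?thesis by auto
  qed
  moreover have "eventually (\<lambda>n. emeasure (interval_measure F) {- real n..t} = ennreal (F t)) sequentially"
  proof -
    obtain n0 where "- t \<le> real n0" using real_arch_simple by blast
    then have "emeasure (interval_measure F) {- real n..t} = ennreal (F t)" if "n0 \<le> n" for n
      using Ioc[of "- real n" t] F(3)[of "- real n"] that by auto
    then show ?thesis by (auto simp: eventually_sequentially)
  qed
  ultimately show "emeasure (interval_measure F) {..t} = ennreal (F t)"
    using LIMSEQ_unique tendsto_eventually by metis
qed

lemma finite_measure_interval_measure:
  fixes F :: "real \<Rightarrow> real"
  assumes F: "mono F" "continuous_on UNIV F" "\<And>t. t \<le> 0 \<Longrightarrow> F t = 0" and "\<And>t. F t \<le> b"
  shows "finite_measure (interval_measure F)"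
proof
  have "(\<lambda>n. emeasure (interval_measure F) {..real n}) \<longlonglongrightarrow> emeasure (interval_measure F) (\<Union>n. {..real n})"
    by (rule Lim_emeasure_incseq) (auto simp: incseq_def)
  moreover have "(\<Union>n. {..real n}) = UNIV" using real_arch_simple by auto
  ultimately have "emeasure (interval_measure F) UNIV \<le> ennreal b"
    using assms(4) by (intro LIMSEQ_le_const2) (auto simp: emeasure_interval_measure_atMost[OF F] intro!: ennreal_leI)
  then show "emeasure (interval_measure F) (space (interval_measure F)) \<noteq> \<infinity>"
    by (auto simp: top_unique)
qed

text \<open>
  Up to the single point \<open>s\<close>, which continuous distribution functions do not charge, an initial segment
  of the line is empty, everything, or of the form \<open>{..s}\<close>.
\<close>

lemma down_closed_real_cases:
  fixes A :: "real set"
  assumes A: "\<And>x y. x \<le> y \<Longrightarrow> y \<in> A \<Longrightarrow> x \<in> A"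
  obtains "A = {}" | "A = UNIV" | s where "{..<s} \<subseteq> A" "A \<subseteq> {..s}"
proof -
  consider (empty) "A = {}" | (bdd) "A \<noteq> {}" "bdd_above A" | (unbdd) "\<not> bdd_above A" by metis
  then show ?thesis
  proof cases
    case bdd
    have "{..<Sup A} \<subseteq> A" using less_cSup_iff[OF bdd] A by (auto intro: less_imp_le)
    moreover have "A \<subseteq> {..Sup A}" using bdd by (auto intro: cSup_upper)
    ultimately show ?thesis by (rule that(3))
  next
    case unbdd
    then have "x \<in> A" for x using A[of x] by (meson bdd_above.I linear)
    then show ?thesis using that(2) by blast
  qed (rule that(1))
qed

lemma emeasure_eq_atMost:
  fixes M :: "real measure"
  assumes "sets M = sets borel" "emeasure M {s} = 0" "A \<in> sets borel" "{..<s} \<subseteq> A" "A \<subseteq> {..s}"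
  shows "emeasure M A = emeasure M {..s}"
proof (rule emeasure_eq_AE)
  have "AE x in M. x \<notin> {s}" by (rule AE_not_in) (use assms in \<open>auto simp: null_sets_def\<close>)
  then show "AE x in M. x \<in> A \<longleftrightarrow> x \<in> {..s}"
    by eventually_elim (use assms in force)
qed (use assms in auto)

section \<open>Gibbs' inequality for Bernoulli laws\<close>

definition neg_log :: "real \<Rightarrow> ennreal" where "neg_log x = e2ennreal (- log_ext x)"

lemma neg_log_eq: "neg_log x = (if x \<le> 0 then \<infinity> else ennreal (- ln x))"
  by (simp add: neg_log_def log_ext_def e2ennreal_infty ennreal.abs_eq)

lemma neg_log_antimono: "x \<le> y \<Longrightarrow> neg_log y \<le> neg_log x"
  by (auto simp: neg_log_eq intro!: ennreal_leI)

lemma neg_log_measurable [measurable]: "neg_log \<in> borel_measurable borel"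
  unfolding neg_log_eq[abs_def] by measurable

text \<open>
  The cross entropy of the Bernoulli laws with success probabilities \<open>a\<close> and \<open>b\<close>.
\<close>

definition cross_entropy :: "real \<Rightarrow> real \<Rightarrow> ennreal" where
  "cross_entropy a b = ennreal (1 - a) * neg_log (1 - b) + ennreal a * neg_log b"

lemma cross_entropy_measurable [measurable]:
  assumes [measurable]: "f \<in> borel_measurable M" "g \<in> borel_measurable M"
  shows "(\<lambda>x. cross_entropy (f x) (g x)) \<in> borel_measurable M"
  unfolding cross_entropy_def by measurable

text \<open>
  Gibbs' inequality in strict form, from \<open>ln u \<le> u - 1\<close> with equality only at 1. At degenerate
  values the infinite logarithms have to be treated by hand: a vanishing weight cancels them, a
  positive one makes the right-hand side infinite.
\<close>

lemma cross_entropy_less: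
  assumes a: "0 \<le> a" "a \<le> 1" and b: "0 \<le> b" "b \<le> 1" and "a \<noteq> b"
  shows "cross_entropy a a < cross_entropy a b"
proof -
  consider "a = 0" | "a = 1" | "0 < a" "a < 1" using a by linarith
  then show ?thesis
  proof cases
    case 1
    then show ?thesis using assms by (auto simp: cross_entropy_def neg_log_eq)
  next
    case 2
    then show ?thesis using assms by (auto simp: cross_entropy_def neg_log_eq)
  next
    case 3
    have cross: "cross_entropy a c = ennreal (- ((1 - a) * ln (1 - c) + a * ln c))"
      if "0 < c" "c < 1" for c
      using that 3 ln_le_zero_iff[of c] ln_le_zero_iff[of "1 - c"]
      by (simp add: cross_entropy_def neg_log_eq ennreal_mult'[symmetric] ennreal_plus[symmetric]
          mult_nonneg_nonpos add_nonneg_nonneg algebra_simps del: ennreal_plus)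
    show ?thesis
    proof (cases "0 < b \<and> b < 1")
      case True
      have "(1 - a) * ln ((1 - b) / (1 - a)) + a * ln (b / a) < (1 - a) * ((1 - b) / (1 - a) - 1) + a * (b / a - 1)"
      proof (rule add_le_less_mono)
        show "(1 - a) * ln ((1 - b) / (1 - a)) \<le> (1 - a) * ((1 - b) / (1 - a) - 1)"
          using True 3 by (intro mult_left_mono ln_le_minus_one) auto
        have "ln (b / a) \<noteq> b / a - 1"
          using ln_eq_minus_one[of "b / a"] True 3 \<open>a \<noteq> b\<close> by auto
        then show "a * ln (b / a) < a * (b / a - 1)"
          using ln_le_minus_one[of "b / a"] True 3 by (intro mult_strict_left_mono) auto
      qed
      also have "\<dots> = 0" using 3 by (simp add: field_simps)
      finally have "(1 - a) * ln (1 - b) + a * ln b < (1 - a) * ln (1 - a) + a * ln a"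
        using True 3 by (simp add: ln_div algebra_simps)
      moreover have "0 \<le> - ((1 - a) * ln (1 - a) + a * ln a)"
        using 3 mult_nonneg_nonpos[of "1 - a" "ln (1 - a)"] mult_nonneg_nonpos[of a "ln a"] by simp
      ultimately show ?thesis using True 3 by (simp add: cross ennreal_less_iff)
    next
      case False
      then have "cross_entropy a b = \<infinity>"
        using 3 b by (auto simp: cross_entropy_def neg_log_eq ennreal_mult_top)
      then show ?thesis using 3 by (simp add: cross)
    qed
  qed
qed

lemma cross_entropy_self_le:
  assumes a: "0 \<le> a" "a \<le> 1" and b: "0 \<le> b" "b \<le> 1"
  shows "cross_entropy a a \<le> cross_entropy a b"
  using cross_entropy_less[OF assms] by (cases "a = b") auto

section \<open>The slope of the hull minimizes the loss\<close>

context cusum_curve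
begin

abbreviation "\<mu>0 \<equiv> interval_measure G0"
abbreviation "\<mu>1 \<equiv> interval_measure G1"
abbreviation "\<mu> \<equiv> interval_measure G"

definition \<nu>0 where "\<nu>0 = density \<mu> (\<lambda>t. ennreal (1 - Fhat t))"
definition \<nu>1 where "\<nu>1 = density \<mu> (\<lambda>t. ennreal (Fhat t))"

lemma mono_G: "mono G"
  by (simp add: mono_def G_mono)

lemma cdf_\<mu>0: "emeasure \<mu>0 {..t} = ennreal (G0 t)" and null_\<mu>0: "emeasure \<mu>0 {t} = 0"
  and fin_\<mu>0: "finite_measure \<mu>0"
  and cdf_\<mu>1: "emeasure \<mu>1 {..t} = ennreal (G1 t)" and null_\<mu>1: "emeasure \<mu>1 {t} = 0"
  and fin_\<mu>1: "finite_measure \<mu>1"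
  using emeasure_interval_measure_atMost[OF mono_G0 cont_G0 G0_nonpos]
    finite_measure_interval_measure[OF mono_G0 cont_G0 G0_nonpos G0_le_1]
    emeasure_interval_measure_atMost[OF mono_G1 cont_G1 G1_nonpos]
    finite_measure_interval_measure[OF mono_G1 cont_G1 G1_nonpos G1_le_1]
  by simp_all

lemma cdf_\<mu>: "emeasure \<mu> {..t} = ennreal (G t)" and null_\<mu>: "emeasure \<mu> {t} = 0"
  using emeasure_interval_measure_atMost[OF mono_G cont_G G_nonpos] by simp_all

lemma fin_\<mu>: "finite_measure \<mu>"
proof (rule finite_measure_interval_measure[OF mono_G cont_G G_nonpos])
  show "G t \<le> 2" for t using G0_le_1[of t] G1_le_1[of t] by (simp add: G_def)
qed

lemma Fhat_measurable [measurable]: "Fhat \<in> borel_measurable borel"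
  by (rule borel_measurable_mono) (simp add: mono_def Fhat_mono)

lemma sets_\<nu>0 [simp, measurable_cong]: "sets \<nu>0 = sets borel"
  and sets_\<nu>1 [simp, measurable_cong]: "sets \<nu>1 = sets borel"
  and space_\<nu>0 [simp]: "space \<nu>0 = UNIV" and space_\<nu>1 [simp]: "space \<nu>1 = UNIV"
  by (simp_all add: \<nu>0_def \<nu>1_def)

lemma null_\<nu>0: "emeasure \<nu>0 {t} = 0" and null_\<nu>1: "emeasure \<nu>1 {t} = 0"
  by (simp_all add: \<nu>0_def \<nu>1_def emeasure_density null_\<mu>)

lemma \<nu>0_plus_\<nu>1: "A \<in> sets borel \<Longrightarrow> emeasure \<nu>0 A + emeasure \<nu>1 A = emeasure \<mu> A"
proof -
  assume A: "A \<in> sets borel"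
  have "emeasure \<nu>0 A + emeasure \<nu>1 A
      = (\<integral>\<^sup>+t. ennreal (1 - Fhat t) * indicator A t + ennreal (Fhat t) * indicator A t \<partial>\<mu>)"
    using A by (simp add: \<nu>0_def \<nu>1_def emeasure_density nn_integral_add)
  also have "\<dots> = (\<integral>\<^sup>+t. indicator A t \<partial>\<mu>)"
    using Fhat_nonneg Fhat_le_1
    by (intro nn_integral_cong) (simp add: distrib_right[symmetric] ennreal_plus[symmetric] del: ennreal_plus)
  finally show ?thesis using A by simp
qed

lemma fin_\<nu>0: "finite_measure \<nu>0" and fin_\<nu>1: "finite_measure \<nu>1"
proof -
  interpret finite_measure \<mu> by (rule fin_\<mu>)
  have "emeasure \<nu>0 UNIV + emeasure \<nu>1 UNIV < top"
    using \<nu>0_plus_\<nu>1[of UNIV] by (simp add: less_top[symmetric])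
  then show "finite_measure \<nu>0" "finite_measure \<nu>1"
    by (auto intro!: finite_measureI simp: less_top)
qed

lemma measure_\<nu>1_Ioc:
  assumes "s \<le> t"
  shows "Fhat s * (G t - G s) \<le> measure \<nu>1 {s<..t}" and "measure \<nu>1 {s<..t} \<le> Fhat t * (G t - G s)"
proof -
  interpret \<nu>1: finite_measure \<nu>1 by (rule fin_\<nu>1)
  have Ioc: "emeasure \<mu> {s<..t} = ennreal (G t - G s)"
    using assms G_mono cont_G
    by (intro emeasure_interval_measure_Ioc) (auto simp: continuous_on_eq_continuous_at continuous_at_imp_continuous_within)
  have \<nu>: "ennreal (measure \<nu>1 {s<..t}) = (\<integral>\<^sup>+x. ennreal (Fhat x) * indicator {s<..t} x \<partial>\<mu>)"
    by (simp add: \<nu>1.emeasure_eq_measure[symmetric]) (simp add: \<nu>1_def emeasure_density)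
  have "ennreal (Fhat s * (G t - G s)) = (\<integral>\<^sup>+x. ennreal (Fhat s) * indicator {s<..t} x \<partial>\<mu>)"
    using Fhat_nonneg by (simp add: nn_integral_cmult Ioc ennreal_mult')
  also have "\<dots> \<le> ennreal (measure \<nu>1 {s<..t})"
    unfolding \<nu> by (intro nn_integral_mono) (auto simp: indicator_def intro!: ennreal_leI Fhat_mono)
  finally show "Fhat s * (G t - G s) \<le> measure \<nu>1 {s<..t}" by simp
  have "ennreal (measure \<nu>1 {s<..t}) \<le> (\<integral>\<^sup>+x. ennreal (Fhat t) * indicator {s<..t} x \<partial>\<mu>)"
    unfolding \<nu> by (intro nn_integral_mono) (auto simp: indicator_def intro!: ennreal_leI Fhat_mono)
  also have "\<dots> = ennreal (Fhat t * (G t - G s))"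
    using Fhat_nonneg by (simp add: nn_integral_cmult Ioc ennreal_mult')
  finally show "measure \<nu>1 {s<..t} \<le> Fhat t * (G t - G s)"
    using Fhat_nonneg G_mono[OF assms] by simp
qed

text \<open>
  The fundamental theorem of calculus for the hull along the curve. Both \<open>\<nu>1\<close> and the increments of
  \<open>H (G t)\<close> lie between the values of \<open>Fhat\<close> at the end points times the increment of \<open>G\<close>.
\<close>

lemma measure_\<nu>1_atMost: "measure \<nu>1 {..t} = H (G t)"
proof -
  interpret \<nu>1: finite_measure \<nu>1 by (rule fin_\<nu>1)
  define E where "E t = measure \<nu>1 {..t} - H (G t)" for t
  have incr: "\<bar>E t - E s\<bar> \<le> (Fhat t - Fhat s) * (G t - G s)" if "s \<le> t" for s t
  proof -
    have "measure \<nu>1 {..t} = measure \<nu>1 {..s} + measure \<nu>1 {s<..t}"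
      using that by (subst \<nu>1.finite_measure_Union[symmetric]) (auto intro!: arg_cong[where f="measure \<nu>1"])
    then show ?thesis
      using measure_\<nu>1_Ioc[OF that] slope_ge_Fhat[OF that] slope_le_Fhat[OF that]
      unfolding E_def left_diff_distrib by linarith
  qed
  have const: "E t = E s" if "s \<le> t" for s t
    by (rule constant_if_increments_le_product[OF cont_G incr that])
  have "emeasure \<nu>1 {..0} \<le> emeasure \<mu> {..0}"
    by (subst \<nu>0_plus_\<nu>1[symmetric]) simp_all
  then have "measure \<nu>1 {..0} = 0" by (simp add: cdf_\<mu> G_nonpos measure_def)
  then have "E 0 = 0" by (simp add: E_def G_nonpos H_0)
  then have "E t = 0" using const[of 0 t] const[of t 0] by (cases "0 \<le> t") auto
  then show ?thesis by (simp add: E_def)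
qed

lemma measure_\<nu>0_atMost: "measure \<nu>0 {..t} = G t - H (G t)"
proof -
  interpret \<nu>0: finite_measure \<nu>0 by (rule fin_\<nu>0)
  interpret \<nu>1: finite_measure \<nu>1 by (rule fin_\<nu>1)
  have "ennreal (measure \<nu>0 {..t} + measure \<nu>1 {..t}) = ennreal (G t)"
    using \<nu>0_plus_\<nu>1[of "{..t}"] by (simp add: \<nu>0.emeasure_eq_measure \<nu>1.emeasure_eq_measure cdf_\<mu>)
  then have "measure \<nu>0 {..t} + measure \<nu>1 {..t} = G t"
    using G0_nonneg[of t] G1_nonneg[of t] by (subst (asm) ennreal_inj) (auto simp: G_def)
  then show ?thesis by (simp add: measure_\<nu>1_atMost)
qed

lemma measure_\<mu>0_atMost: "measure \<mu>0 {..t} = G0 t" and measure_\<mu>1_atMost: "measure \<mu>1 {..t} = G1 t"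
  using G0_nonneg G1_nonneg by (simp_all add: measure_def cdf_\<mu>0 cdf_\<mu>1)

lemma measure_atMost_tendsto:
  assumes "finite_measure M" "sets M = sets borel"
  shows "(\<lambda>n. measure M {..real n}) \<longlonglongrightarrow> measure M UNIV"
proof -
  interpret finite_measure M by fact
  have "(\<Union>n. {..real n}) = UNIV" using real_arch_simple by auto
  then show ?thesis
    using finite_Lim_measure_incseq[of "\<lambda>n. {..real n}"] assms(2)
    by (simp add: incseq_def image_subset_iff)
qed

text \<open>
  The total masses agree because the gap between diagram and hull, at most the remaining \<open>G0\<close>-mass,
  vanishes at infinity.
\<close>

lemma total_\<nu>0: "measure \<nu>0 UNIV = measure \<mu>0 UNIV" and total_\<nu>1: "measure \<nu>1 UNIV = measure \<mu>1 UNIV"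
proof -
  interpret \<mu>0: finite_measure \<mu>0 by (rule fin_\<mu>0)
  define T where "T = measure \<mu>0 UNIV"
  have G0_le: "G0 t \<le> T" for t
    using \<mu>0.finite_measure_mono[of "{..t}" UNIV] by (simp add: T_def measure_\<mu>0_atMost)
  have lim0: "(\<lambda>n. G0 (real n)) \<longlonglongrightarrow> T"
    using measure_atMost_tendsto[OF fin_\<mu>0] by (simp add: measure_\<mu>0_atMost T_def)
  have lim1: "(\<lambda>n. G1 (real n)) \<longlonglongrightarrow> measure \<mu>1 UNIV"
    using measure_atMost_tendsto[OF fin_\<mu>1] by (simp add: measure_\<mu>1_atMost)
  have "(\<lambda>n. T - G0 (real n)) \<longlonglongrightarrow> 0" using tendsto_diff[OF tendsto_const lim0, of T] by simp
  note gap = this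
  have "0 \<le> G1 (real n) - H (G (real n))" "G1 (real n) - H (G (real n)) \<le> T - G0 (real n)" for n
    using H_G_le[of "real n"] deficit_le[OF G0_le, of "real n"] by simp_all
  then have deficit: "(\<lambda>n. G1 (real n) - H (G (real n))) \<longlonglongrightarrow> 0"
    by (intro tendsto_sandwich[OF always_eventually always_eventually tendsto_const gap] allI)
  have "(\<lambda>n. H (G (real n))) \<longlonglongrightarrow> measure \<mu>1 UNIV"
    using tendsto_diff[OF lim1 deficit] by simp
  moreover have "(\<lambda>n. H (G (real n))) \<longlonglongrightarrow> measure \<nu>1 UNIV"
    using measure_atMost_tendsto[OF fin_\<nu>1] by (simp add: measure_\<nu>1_atMost)
  ultimately show "measure \<nu>1 UNIV = measure \<mu>1 UNIV" by (rule LIMSEQ_unique[rotated])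
  have "(\<lambda>n. G (real n) - H (G (real n))) \<longlonglongrightarrow> T"
    using tendsto_add[OF lim0 deficit] by (simp add: G_def add_diff_eq)
  moreover have "(\<lambda>n. G (real n) - H (G (real n))) \<longlonglongrightarrow> measure \<nu>0 UNIV"
    using measure_atMost_tendsto[OF fin_\<nu>0] by (simp add: measure_\<nu>0_atMost)
  ultimately show "measure \<nu>0 UNIV = measure \<mu>0 UNIV" unfolding T_def by (rule LIMSEQ_unique[rotated])
qed

lemma measure_initial_segment:
  assumes A: "A \<in> sets borel" "{..<s} \<subseteq> A" "A \<subseteq> {..s}"
  shows "measure \<mu>0 A = G0 s" "measure \<mu>1 A = G1 s"
    "measure \<nu>0 A = G s - H (G s)" "measure \<nu>1 A = H (G s)"
  using emeasure_eq_atMost[OF _ null_\<mu>0 A] emeasure_eq_atMost[OF _ null_\<mu>1 A]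
    emeasure_eq_atMost[OF _ null_\<nu>0 A] emeasure_eq_atMost[OF _ null_\<nu>1 A]
    measure_\<nu>0_atMost[of s] measure_\<nu>1_atMost[of s] measure_\<mu>0_atMost[of s] measure_\<mu>1_atMost[of s]
  by (simp_all add: measure_def)

text \<open>
  The hull lies below the diagram. For final segments the inequality is reversed twice, by passing
  to the complement and from \<open>G1\<close> to \<open>G0\<close>.
\<close>

lemma segment_dominance:
  assumes A: "A \<in> sets borel" and down: "\<And>x y. x \<le> y \<Longrightarrow> y \<in> A \<Longrightarrow> x \<in> A"
  shows "emeasure \<nu>1 A \<le> emeasure \<mu>1 A" and "emeasure \<nu>0 (- A) \<le> emeasure \<mu>0 (- A)"
proof -
  interpret \<mu>0: finite_measure \<mu>0 by (rule fin_\<mu>0)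
  interpret \<mu>1: finite_measure \<mu>1 by (rule fin_\<mu>1)
  interpret \<nu>0: finite_measure \<nu>0 by (rule fin_\<nu>0)
  interpret \<nu>1: finite_measure \<nu>1 by (rule fin_\<nu>1)
  have compl: "measure \<nu>0 (- A) = measure \<mu>0 UNIV - measure \<nu>0 A" "measure \<mu>0 (- A) = measure \<mu>0 UNIV - measure \<mu>0 A"
    using \<nu>0.finite_measure_compl[of A] \<mu>0.finite_measure_compl[of A] A by (simp_all add: Compl_eq_Diff_UNIV total_\<nu>0)
  have "measure \<nu>1 A \<le> measure \<mu>1 A \<and> measure \<mu>0 A \<le> measure \<nu>0 A"
  proof (rule down_closed_real_cases[OF down])
    assume "A = UNIV" then show ?thesis by (simp add: total_\<nu>0 total_\<nu>1)
  next
    fix s assume s: "{..<s} \<subseteq> A" "A \<subseteq> {..s}"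
    show ?thesis using measure_initial_segment[OF A s] H_G_le[of s] by (simp add: G_def)
  qed auto
  then show "emeasure \<nu>1 A \<le> emeasure \<mu>1 A" "emeasure \<nu>0 (- A) \<le> emeasure \<mu>0 (- A)"
    by (simp_all add: \<mu>0.emeasure_eq_measure \<mu>1.emeasure_eq_measure \<nu>0.emeasure_eq_measure \<nu>1.emeasure_eq_measure compl
        ennreal_leI)
qed

text \<open>
  Before the right end \<open>s\<close> of a sublevel set the slope is below the level, and at \<open>s\<close> it has reached
  the level by right-continuity. There hull and diagram touch, so both assign the same mass to it.
\<close>

lemma emeasure_sublevel_eq:
  "emeasure \<mu>1 {t. Fhat t < c} = emeasure \<nu>1 {t. Fhat t < c}"
  "emeasure \<mu>0 {t. Fhat t < c} = emeasure \<nu>0 {t. Fhat t < c}"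
proof -
  interpret \<mu>0: finite_measure \<mu>0 by (rule fin_\<mu>0)
  interpret \<mu>1: finite_measure \<mu>1 by (rule fin_\<mu>1)
  interpret \<nu>0: finite_measure \<nu>0 by (rule fin_\<nu>0)
  interpret \<nu>1: finite_measure \<nu>1 by (rule fin_\<nu>1)
  define A where "A = {t. Fhat t < c}"
  have A: "A \<in> sets borel" unfolding A_def by measurable
  have down: "x \<in> A" if "x \<le> y" "y \<in> A" for x y
    using that Fhat_mono[of x y] by (simp add: A_def)
  have "measure \<mu>1 A = measure \<nu>1 A \<and> measure \<mu>0 A = measure \<nu>0 A"
  proof (rule down_closed_real_cases[of A])
    fix s assume s: "{..<s} \<subseteq> A" "A \<subseteq> {..s}"
    have "c \<le> Fhat s"
    proof (rule tendsto_lowerbound)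
      show "(Fhat \<longlongrightarrow> Fhat s) (at_right s)" using Fhat_right_cont[of s] by (simp add: continuous_within)
      have "c \<le> Fhat u" if "s < u" for u
      proof -
        have "u \<notin> A" using s(2) that by auto
        then show ?thesis by (simp add: A_def)
      qed
      then show "\<forall>\<^sub>F u in at_right s. c \<le> Fhat u" by (rule eventually_mono[OF eventually_at_right_less])
    qed (rule trivial_limit_at_right_real)
    have "Fhat u < Fhat s" if "u < s" for u
    proof -
      have "u \<in> A" using s(1) that by auto
      then show ?thesis using \<open>c \<le> Fhat s\<close> by (simp add: A_def)
    qed
    then have "H (G s) = G1 s" by (rule touching)
    then show ?thesis using measure_initial_segment[OF A s] by (simp add: G_def)
  qed (use down in \<open>auto simp: total_\<nu>0 total_\<nu>1\<close>)
  then show "emeasure \<mu>1 {t. Fhat t < c} = emeasure \<nu>1 {t. Fhat t < c}"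
    "emeasure \<mu>0 {t. Fhat t < c} = emeasure \<nu>0 {t. Fhat t < c}"
    by (simp_all add: \<mu>0.emeasure_eq_measure \<mu>1.emeasure_eq_measure \<nu>0.emeasure_eq_measure \<nu>1.emeasure_eq_measure A_def)
qed

text \<open>
  The negative of the smoothed log likelihood, as an extended nonnegative number.
\<close>

definition loss :: "(real \<Rightarrow> real) \<Rightarrow> ennreal" where
  "loss F = (\<integral>\<^sup>+t. neg_log (1 - F t) \<partial>\<mu>0) + (\<integral>\<^sup>+t. neg_log (F t) \<partial>\<mu>1)"

lemma integral_\<nu>:
  assumes [measurable]: "F \<in> borel_measurable borel"
  shows "(\<integral>\<^sup>+t. neg_log (1 - F t) \<partial>\<nu>0) + (\<integral>\<^sup>+t. neg_log (F t) \<partial>\<nu>1) = (\<integral>\<^sup>+t. cross_entropy (Fhat t) (F t) \<partial>\<mu>)"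
  unfolding \<nu>0_def \<nu>1_def cross_entropy_def
  by (simp add: nn_integral_density nn_integral_add)

text \<open>
  Each of the two integrals decreases when the measures of the diagram are replaced by those of the
  hull, by comparison of the level sets.
\<close>

lemma loss_ge:
  assumes F: "mono F"
  shows "(\<integral>\<^sup>+t. cross_entropy (Fhat t) (F t) \<partial>\<mu>) \<le> loss F"
proof -
  have [measurable]: "F \<in> borel_measurable borel" by (rule borel_measurable_mono[OF F])
  have mono: "F x \<le> F y" if "x \<le> y" for x y using F that by (simp add: mono_def)
  note sf = finite_measure.axioms(1)
  have "(\<integral>\<^sup>+t. neg_log (F t) \<partial>\<nu>1) \<le> (\<integral>\<^sup>+t. neg_log (F t) \<partial>\<mu>1)"
  proof (rule nn_integral_mono_levels)
    fix y :: real
    show "emeasure \<nu>1 {t \<in> space \<nu>1. ennreal y < neg_log (F t)} \<le> emeasure \<mu>1 {t \<in> space \<mu>1. ennreal y < neg_log (F t)}"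
      using segment_dominance(1)[of "{t. ennreal y < neg_log (F t)}"] neg_log_antimono[OF mono]
      by (force dest: order.strict_trans2)
  qed (use fin_\<nu>1 fin_\<mu>1 in \<open>auto dest: sf\<close>)
  moreover have "(\<integral>\<^sup>+t. neg_log (1 - F t) \<partial>\<nu>0) \<le> (\<integral>\<^sup>+t. neg_log (1 - F t) \<partial>\<mu>0)"
  proof (rule nn_integral_mono_levels)
    fix y :: real
    define A where "A = {t. \<not> ennreal y < neg_log (1 - F t)}"
    have A: "A \<in> sets borel" unfolding A_def by measurable
    have "x \<in> A" if "x \<le> z" "z \<in> A" for x z
      using that neg_log_antimono[of "1 - F z" "1 - F x"] mono[of x z] by (auto simp: A_def not_less)
    then show "emeasure \<nu>0 {t \<in> space \<nu>0. ennreal y < neg_log (1 - F t)} \<le> emeasure \<mu>0 {t \<in> space \<mu>0. ennreal y < neg_log (1 - F t)}"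
      using segment_dominance(2)[OF A] by (simp add: A_def Collect_neg_eq[symmetric])
  qed (use fin_\<nu>0 fin_\<mu>0 in \<open>auto dest: sf\<close>)
  ultimately show ?thesis
    unfolding loss_def integral_\<nu>[OF \<open>F \<in> borel_measurable borel\<close>, symmetric] by (intro add_mono)
qed

lemma loss_Fhat: "loss Fhat = (\<integral>\<^sup>+t. cross_entropy (Fhat t) (Fhat t) \<partial>\<mu>)"
proof -
  have "(\<integral>\<^sup>+t. neg_log (Fhat t) \<partial>\<mu>1) = (\<integral>\<^sup>+t. neg_log (Fhat t) \<partial>\<nu>1)"
    by (rule nn_integral_comp_eq_of_sublevels[OF fin_\<mu>1]) (auto simp: emeasure_sublevel_eq)
  moreover have "(\<integral>\<^sup>+t. neg_log (1 - Fhat t) \<partial>\<mu>0) = (\<integral>\<^sup>+t. neg_log (1 - Fhat t) \<partial>\<nu>0)"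
    by (rule nn_integral_comp_eq_of_sublevels[OF fin_\<mu>0, where k = "\<lambda>x. neg_log (1 - x)"]) (auto simp: emeasure_sublevel_eq)
  ultimately show ?thesis unfolding loss_def by (simp add: integral_\<nu>)
qed

text \<open>
  Compare with the constant function \<open>1/2\<close>, whose cross entropy is \<open>ln 2\<close> whatever the first argument.
\<close>

lemma loss_Fhat_finite: "loss Fhat < \<infinity>"
proof -
  interpret finite_measure \<mu> by (rule fin_\<mu>)
  have "loss Fhat \<le> (\<integral>\<^sup>+t. cross_entropy (Fhat t) (1/2) \<partial>\<mu>)"
    unfolding loss_Fhat using Fhat_nonneg Fhat_le_1
    by (intro nn_integral_mono cross_entropy_self_le) auto
  also have "\<dots> = (\<integral>\<^sup>+t. ennreal (ln 2) \<partial>\<mu>)"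
  proof (rule nn_integral_cong)
    fix t
    have "cross_entropy (Fhat t) (1/2) = (ennreal (1 - Fhat t) + ennreal (Fhat t)) * ennreal (ln 2)"
      by (simp add: cross_entropy_def neg_log_eq ln_div distrib_right)
    also have "\<dots> = ennreal (ln 2)"
      using Fhat_nonneg Fhat_le_1 by (simp add: ennreal_plus[symmetric] del: ennreal_plus)
    finally show "cross_entropy (Fhat t) (1/2) = ennreal (ln 2)" .
  qed
  also have "\<dots> < \<infinity>" by (simp add: ennreal_mult_less_top emeasure_eq_measure)
  finally show ?thesis .
qed

lemma Fhat_minimizes_loss:
  assumes F: "mono F" "\<And>t. 0 \<le> F t" "\<And>t. F t \<le> 1"
  shows "loss Fhat \<le> loss F"
  unfolding loss_Fhat
  by (rule order_trans[OF nn_integral_mono loss_ge[OF F(1)]])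
    (use F Fhat_nonneg Fhat_le_1 in \<open>auto intro: cross_entropy_self_le\<close>)

lemma loss_minimizer_unique_AE:
  assumes F: "mono F" "\<And>t. 0 \<le> F t" "\<And>t. F t \<le> 1" and le: "loss F \<le> loss Fhat"
  shows "AE t in \<mu>. F t = Fhat t"
proof (rule ccontr)
  assume neq: "\<not> ?thesis"
  have [measurable]: "F \<in> borel_measurable borel" by (rule borel_measurable_mono[OF F(1)])
  have le_eq: "cross_entropy (Fhat t) (F t) \<le> cross_entropy (Fhat t) (Fhat t) \<longleftrightarrow> F t = Fhat t" for t
    using cross_entropy_less[of "Fhat t" "F t"] F Fhat_nonneg Fhat_le_1 by (metis not_le order_refl)
  have "(\<integral>\<^sup>+t. cross_entropy (Fhat t) (Fhat t) \<partial>\<mu>) < (\<integral>\<^sup>+t. cross_entropy (Fhat t) (F t) \<partial>\<mu>)"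
  proof (rule nn_integral_less)
    show "(\<integral>\<^sup>+t. cross_entropy (Fhat t) (Fhat t) \<partial>\<mu>) \<noteq> \<infinity>"
      using loss_Fhat_finite by (simp add: loss_Fhat)
    show "AE t in \<mu>. cross_entropy (Fhat t) (Fhat t) \<le> cross_entropy (Fhat t) (F t)"
      using F Fhat_nonneg Fhat_le_1 by (intro AE_I2 cross_entropy_self_le) auto
    show "\<not> (AE t in \<mu>. cross_entropy (Fhat t) (F t) \<le> cross_entropy (Fhat t) (Fhat t))"
      unfolding le_eq by (rule neq)
  qed measurable
  also have "\<dots> \<le> loss F" by (rule loss_ge[OF F(1)])
  also have "\<dots> \<le> (\<integral>\<^sup>+t. cross_entropy (Fhat t) (Fhat t) \<partial>\<mu>)" using le unfolding loss_Fhat .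
  finally show False by simp
qed

text \<open>
  Immediately to the right of a point of increase every interval has positive mass and so contains
  points of agreement; both functions are right-continuous.
\<close>

lemma eq_Fhat_if_AE_eq:
  assumes F: "AE t in \<mu>. F t = Fhat t" and cont: "continuous (at_right t) F"
    and inc: "\<And>s. t < s \<Longrightarrow> G t < G s"
  shows "F t = Fhat t"
proof -
  have near: "\<exists>u. t < u \<and> u < s \<and> F u = Fhat u" if "t < s" for s
  proof (rule ccontr)
    assume none: "\<nexists>u. t < u \<and> u < s \<and> F u = Fhat u"
    define m where "m = (t + s) / 2"
    have m: "t < m" "m < s" using that by (auto simp: m_def)
    have "AE u in \<mu>. u \<notin> {t<..m}" using F by eventually_elim (use none m in force)
    then have "emeasure \<mu> {t<..m} = 0"
      by (subst AE_iff_measurable[symmetric, where P = "\<lambda>u. u \<notin> {t<..m}"]) auto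
    moreover have "emeasure \<mu> {t<..m} = ennreal (G m - G t)"
      using m G_mono cont_G
      by (intro emeasure_interval_measure_Ioc) (auto simp: continuous_on_eq_continuous_at continuous_at_imp_continuous_within)
    ultimately show False using inc[OF m(1)] by (simp add: ennreal_eq_0_iff)
  qed
  have "((\<lambda>u. F u - Fhat u) \<longlongrightarrow> F t - Fhat t) (at_right t)"
    using cont Fhat_right_cont[of t] by (intro tendsto_diff) (simp_all add: continuous_within)
  note lim = this
  show ?thesis
  proof (rule ccontr)
    assume "F t \<noteq> Fhat t"
    then have "\<forall>\<^sub>F u in at_right t. F u - Fhat u \<noteq> 0"
      by (intro tendsto_imp_eventually_ne[OF lim]) simp
    then obtain b where b: "t < b" "\<And>u. t < u \<Longrightarrow> u < b \<Longrightarrow> F u - Fhat u \<noteq> 0"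
      unfolding eventually_at_right[OF less_add_one[of t]] by blast
    then show False using near[OF b(1)] by force
  qed
qed

end

section \<open>Smoothed sub-distribution functions on the half-line\<close>

lemma has_lebesgue_density_integral:
  assumes "has_lebesgue_density G g" and "0 \<le> t"
  shows "g integrable_on {0..t}" and "G t = integral {0..t} g"
  using assms set_borel_integral_eq_integral[of "{0..t}" g] set_lebesgue_integral_eq_integral[of "{0..t}" g]
  by (auto simp: has_lebesgue_density_def)

lemma has_lebesgue_density_0: "has_lebesgue_density G g \<Longrightarrow> G 0 = 0"
  using has_lebesgue_density_integral(2)[of G g 0] by simp

lemma has_lebesgue_density_continuous:
  assumes G: "has_lebesgue_density G g"
  shows "continuous_on UNIV (\<lambda>t. G (max 0 t))"
proof (rule continuous_at_imp_continuous_on, rule ballI)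
  fix t :: real
  define b where "b = \<bar>t\<bar> + 1"
  have "continuous_on {0..b} (\<lambda>t. integral {0..t} g)"
    by (rule indefinite_integral_continuous_1) (use has_lebesgue_density_integral(1)[OF G, of b] in \<open>simp add: b_def\<close>)
  then have "continuous_on {0..b} G"
    by (rule continuous_on_eq) (simp add: has_lebesgue_density_integral(2)[OF G])
  then have "continuous_on {..<b} (\<lambda>t. G (max 0 t))"
    by (rule continuous_on_compose2) (auto intro!: continuous_intros simp: b_def)
  moreover have "t \<in> {..<b}" by (simp add: b_def)
  ultimately show "isCont (\<lambda>t. G (max 0 t)) t"
    by (simp add: continuous_on_eq_continuous_at)
qed

lemma has_lebesgue_density_const:
  assumes G: "has_lebesgue_density G g" and ab: "0 \<le> a" "a \<le> b" and zero: "\<And>t. a < t \<Longrightarrow> g t = 0"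
  shows "G b = G a"
proof -
  have "(g has_integral 0) {a..b}"
    by (rule has_integral_spike_finite[of "{a}" _ _ "\<lambda>_. 0"]) (use zero in auto)
  then have "integral {a..b} g = 0" by (rule integral_unique)
  moreover have "integral {0..a} g + integral {a..b} g = integral {0..b} g"
    using ab by (intro Henstock_Kurzweil_Integration.integral_combine has_lebesgue_density_integral(1)[OF G]) auto
  ultimately show ?thesis using ab by (simp add: has_lebesgue_density_integral(2)[OF G])
qed

lemma (in cusum_curve) diagram_eq: "diagram = {(G t, G1 t) | t. 0 \<le> t}"
proof -
  have "(G t, G1 t) = (G (max 0 t), G1 (max 0 t))" for t
    by (cases "0 \<le> t") (simp_all add: G_nonpos G1_nonpos)
  then show ?thesis unfolding diagram_def by (auto intro: max.cobounded1)
qed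

text \<open>
  The cut-off of the diagram at the end of the support only discards repetitions of its last point,
  because \<open>G0\<close> and \<open>G1\<close> are constant from there on. If the densities vanish identically then the
  support is empty and its end is \<open>-\<infinity>\<close>, so that the diagram is empty rather than a single point; both have
  slope 0 by convention.
\<close>

lemma msle_eq_hull_slope:
  assumes "has_lebesgue_density G0 g0" "has_lebesgue_density G1 g1" and "0 \<le> t"
  shows "msle G0 G1 g0 g1 t = hull_slope {(G0 s + G1 s, G1 s) | s. 0 \<le> s} (G0 t + G1 t)"
proof (cases "{t. 0 \<le> t \<and> 0 < g0 t + g1 t} = {}")
  case True
  have "g0 s = 0 \<and> g1 s = 0" if "0 < s" for s
    using True assms that by (auto simp: has_lebesgue_density_def not_less intro: order_antisym dest!: spec[of _ s])
  then have zero: "G0 s = 0" "G1 s = 0" if "0 \<le> s" for s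
    using has_lebesgue_density_const[OF assms(1) _ that] has_lebesgue_density_const[OF assms(2) _ that]
      assms(1,2)[THEN has_lebesgue_density_0] by auto
  have "ccsd G0 G1 g0 g1 = {}"
    unfolding ccsd_def support_end_def True by (simp add: bot_ereal_def)
  moreover have "{(G0 s + G1 s, G1 s) | s. 0 \<le> s} = {(0, 0)}"
    using zero by (auto intro!: exI[of _ 0])
  ultimately show ?thesis using zero[OF assms(3)] by (simp add: msle_def hull_slope_def)
next
  case False
  define \<tau> where "\<tau> = support_end g0 g1"
  have upper: "ereal t \<le> \<tau>" if "0 \<le> t" "0 < g0 t + g1 t" for t
    unfolding \<tau>_def support_end_def using that by (auto intro: SUP_upper)
  obtain t0 where "0 \<le> t0" "0 < g0 t0 + g1 t0" using False by auto
  then have \<tau>0: "0 \<le> \<tau>" using upper[of t0] by (metis ereal_less_eq(5) order_trans)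
  have "\<exists>r. 0 \<le> r \<and> ereal r \<le> \<tau> \<and> G0 r = G0 s \<and> G1 r = G1 s" if s: "0 \<le> s" for s
  proof (cases "ereal s \<le> \<tau>")
    case False
    with \<tau>0 obtain r where r: "\<tau> = ereal r" "0 \<le> r" "r < s" by (cases \<tau>) auto
    have "g0 u = 0 \<and> g1 u = 0" if "r < u" for u
    proof -
      have "\<not> 0 < g0 u + g1 u" using upper[of u] r that by auto
      moreover have "0 \<le> g0 u" "0 \<le> g1 u" using assms r that by (auto simp: has_lebesgue_density_def)
      ultimately show ?thesis by linarith
    qed
    then have "G0 s = G0 r" "G1 s = G1 r"
      using has_lebesgue_density_const[OF assms(1) r(2), of s] has_lebesgue_density_const[OF assms(2) r(2), of s] r
      by auto
    then show ?thesis using r by auto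
  qed (use s in auto)
  note earlier = this
  have "ccsd G0 G1 g0 g1 = {(G0 s + G1 s, G1 s) | s. 0 \<le> s}"
  proof (rule set_eqI, rule iffI)
    fix p assume "p \<in> {(G0 s + G1 s, G1 s) | s. 0 \<le> s}"
    then obtain s where s: "0 \<le> s" "p = (G0 s + G1 s, G1 s)" by blast
    obtain r where r: "0 \<le> r" "ereal r \<le> \<tau>" "G0 r = G0 s" "G1 r = G1 s"
      using earlier[OF s(1)] by blast
    have "p = (G0 r + G1 r, G1 r)" using s r by simp
    then show "p \<in> ccsd G0 G1 g0 g1" using r unfolding ccsd_def \<tau>_def by blast
  qed (auto simp: ccsd_def)
  then show ?thesis by (simp add: msle_def)
qed

lemma stieltjes_eq: "G 0 = 0 \<Longrightarrow> stieltjes G = interval_measure (\<lambda>t. G (max 0 t))"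
  unfolding stieltjes_def by (rule arg_cong[where f=interval_measure]) (auto simp: max_def)

lemma enn2ereal_minus_add: "- enn2ereal a + - enn2ereal b = - enn2ereal (a + b)"
  using enn2ereal_nonneg[of a] enn2ereal_nonneg[of b]
  by (cases "enn2ereal a"; cases "enn2ereal b") (auto simp: plus_ennreal.rep_eq)

theorem theorem3p1:
  fixes G0 G1 g0 g1 :: "real \<Rightarrow> real"
  assumes "sub_distribution G0" and "has_lebesgue_density G0 g0"
    and "sub_distribution G1" and "has_lebesgue_density G1 g1"
  shows "is_arg_max (smoothed_loglik G0 G1) sub_distribution (msle G0 G1 g0 g1) \<and>
    (\<forall>F. is_arg_max (smoothed_loglik G0 G1) sub_distribution F \<longrightarrow>
       (AE t in stieltjes (\<lambda>t. G0 t + G1 t). F t = msle G0 G1 g0 g1 t) \<and>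
       (\<forall>t\<ge>0. (\<forall>s>t. G0 t + G1 t < G0 s + G1 s) \<longrightarrow> F t = msle G0 G1 g0 g1 t))"
proof -
  \<comment> \<open>Only values at nonnegative times enter the likelihood and the diagram, so every function may be
  extended to the left by its value at 0.\<close>
  define ext where "ext f t = f (max 0 t)" for f :: "real \<Rightarrow> real" and t
  have ext_sub: "mono (ext F) \<and> (\<forall>t. 0 \<le> ext F t \<and> ext F t \<le> 1)" if "sub_distribution F" for F
    using that by (auto simp: sub_distribution_def mono_on_def mono_def ext_def)
  have G0_0: "G0 0 = 0" and G1_0: "G1 0 = 0"
    using assms(2,4) by (auto dest: has_lebesgue_density_0)
  have ext_nonpos: "ext G0 t = 0" "ext G1 t = 0" if "t \<le> 0" for t
    using that by (simp_all add: ext_def max_def G0_0 G1_0)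
  interpret C: cusum_curve "ext G0" "ext G1"
    by unfold_locales
      (use ext_sub[OF assms(1)] ext_sub[OF assms(3)] ext_nonpos
        assms(2,4)[THEN has_lebesgue_density_continuous] in \<open>auto simp: ext_def[abs_def]\<close>)
  have msle: "msle G0 G1 g0 g1 t = C.Fhat t" if "0 \<le> t" for t
  proof -
    have "C.diagram = {(G0 s + G1 s, G1 s) | s. 0 \<le> s}"
      unfolding C.diagram_eq C.G_def by (intro Collect_cong ex_cong1) (auto simp: ext_def)
    then show ?thesis
      using that msle_eq_hull_slope[OF assms(2,4) that] by (simp add: C.Fhat_def C.G_def ext_def)
  qed
  have Fhat_ext: "ext (msle G0 G1 g0 g1) = C.Fhat"
  proof
    fix t show "ext (msle G0 G1 g0 g1) t = C.Fhat t"
      using msle[of "max 0 t"] C.Fhat_cong[of "max 0 t" t]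
      by (cases "0 \<le> t") (simp_all add: ext_def C.G_nonpos)
  qed
  have st0: "stieltjes G0 = C.\<mu>0" and st1: "stieltjes G1 = C.\<mu>1"
    using stieltjes_eq[of G0, OF G0_0] stieltjes_eq[of G1, OF G1_0] by (simp_all add: ext_def[abs_def])
  have st: "stieltjes (\<lambda>t. G0 t + G1 t) = C.\<mu>"
  proof -
    have "C.G = (\<lambda>t. G0 (max 0 t) + G1 (max 0 t))" by (simp add: fun_eq_iff C.G_def ext_def)
    then show ?thesis using stieltjes_eq[of "\<lambda>t. G0 t + G1 t"] G0_0 G1_0 by simp
  qed
  have pos: "AE t in M. 0 < t" if "sets M = sets borel" "emeasure M {..0} = 0" for M :: "real measure"
    using AE_not_in[of "{..0}" M] that by (auto simp: null_sets_def)
  have pos0: "AE t in C.\<mu>0. 0 < t" and pos1: "AE t in C.\<mu>1. 0 < t"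
    by (rule pos; simp add: C.cdf_\<mu>0 C.cdf_\<mu>1 ext_nonpos)+
  have loglik: "smoothed_loglik G0 G1 F = - enn2ereal (C.loss (ext F))" for F
  proof -
    have "(\<integral>\<^sup>+t\<in>{0..}. neg_log (1 - F t) \<partial>C.\<mu>0) = (\<integral>\<^sup>+t. neg_log (1 - ext F t) \<partial>C.\<mu>0)"
      by (rule nn_integral_cong_AE, rule AE_mp[OF pos0]) (simp add: ext_def)
    moreover have "(\<integral>\<^sup>+t\<in>{0..}. neg_log (F t) \<partial>C.\<mu>1) = (\<integral>\<^sup>+t. neg_log (ext F t) \<partial>C.\<mu>1)"
      by (rule nn_integral_cong_AE, rule AE_mp[OF pos1]) (simp add: ext_def)
    ultimately show ?thesis
      by (simp add: smoothed_loglik_def integral_nonpos_def st0 st1 neg_log_def[symmetric]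
          enn2ereal_minus_add C.loss_def)
  qed
  have less_iff: "smoothed_loglik G0 G1 E < smoothed_loglik G0 G1 F \<longleftrightarrow> C.loss (ext F) < C.loss (ext E)" for E F
    unfolding loglik by (simp add: less_ennreal.rep_eq)
  have sub: "sub_distribution (msle G0 G1 g0 g1)"
    unfolding sub_distribution_def
  proof (intro conjI allI impI)
    show "mono_on {0..} (msle G0 G1 g0 g1)"
      by (rule mono_onI) (simp add: msle C.Fhat_mono)
    fix t :: real assume t: "0 \<le> t"
    show "0 \<le> msle G0 G1 g0 g1 t" "msle G0 G1 g0 g1 t \<le> 1"
      using t by (simp_all add: msle C.Fhat_nonneg C.Fhat_le_1)
    have "\<forall>\<^sub>F s in at_right t. C.Fhat s = msle G0 G1 g0 g1 s"
      by (rule eventually_mono[OF eventually_at_right_less]) (use t msle in simp)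
    moreover have "(C.Fhat \<longlongrightarrow> C.Fhat t) (at_right t)"
      using C.Fhat_right_cont[of t] by (simp add: continuous_within)
    ultimately show "continuous (at_right t) (msle G0 G1 g0 g1)"
      unfolding continuous_within msle[OF t] by (rule Lim_transform_eventually[rotated])
  qed
  have max: "is_arg_max (smoothed_loglik G0 G1) sub_distribution (msle G0 G1 g0 g1)"
    unfolding is_arg_max_def less_iff Fhat_ext
    using sub C.Fhat_minimizes_loss ext_sub by (meson not_le)
  moreover have "(AE t in stieltjes (\<lambda>t. G0 t + G1 t). F t = msle G0 G1 g0 g1 t) \<and>
       (\<forall>t\<ge>0. (\<forall>s>t. G0 t + G1 t < G0 s + G1 s) \<longrightarrow> F t = msle G0 G1 g0 g1 t)"
    if F: "is_arg_max (smoothed_loglik G0 G1) sub_distribution F" for F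
  proof -
    have F_sub: "sub_distribution F" and "\<not> C.loss C.Fhat < C.loss (ext F)"
      using F sub unfolding is_arg_max_def less_iff Fhat_ext[symmetric] by blast+
    then have AE: "AE t in C.\<mu>. ext F t = C.Fhat t"
      using ext_sub[OF F_sub] by (intro C.loss_minimizer_unique_AE) (auto simp: not_less)
    moreover have "AE t in C.\<mu>. 0 < t"
      by (rule pos) (simp_all add: C.cdf_\<mu> C.G_nonpos)
    ultimately have "AE t in C.\<mu>. F t = msle G0 G1 g0 g1 t"
      by eventually_elim (simp add: ext_def msle)
    moreover have "F t = msle G0 G1 g0 g1 t" if t: "0 \<le> t" and inc: "\<forall>s>t. G0 t + G1 t < G0 s + G1 s" for t
    proof -
      have "\<forall>\<^sub>F s in at_right t. F s = ext F s"
        by (rule eventually_mono[OF eventually_at_right_less]) (use t in \<open>simp add: ext_def\<close>)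
      moreover have "(F \<longlongrightarrow> F t) (at_right t)"
        using F_sub t by (simp add: sub_distribution_def continuous_within)
      ultimately have "(ext F \<longlongrightarrow> F t) (at_right t)"
        by (rule Lim_transform_eventually[rotated])
      then have "continuous (at_right t) (ext F)" using t by (simp add: continuous_within ext_def)
      then have "ext F t = C.Fhat t"
        by (rule C.eq_Fhat_if_AE_eq[OF AE]) (use inc t in \<open>simp add: C.G_def ext_def\<close>)
      then show ?thesis using t by (simp add: ext_def msle)
    qed
    ultimately show ?thesis unfolding st by blast
  qed
  ultimately show ?thesis by blast
qed

end
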